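(* Let $\tilde\kappa>\frac1\pi$ be a constant independent of $\beta$, let $\beta>0$ and $\kappa=\tilde\kappa/\beta$ (so $\kappa>\frac{1}{\pi\beta}$), and let $\varphi_\beta$ be a minimizer of $F_{\beta,\kappa}$ in $\mathcal J$. Then, for $\beta>0$ small enough, there exists a unique $T\in(0,1)$ such that $\varphi_\beta(T)=\pi$, and $\varphi_\beta(x+T)=\pi+\varphi_\beta(x)$ for every $x\in[0,1-T]$. Setting $N:=E(1/T)$ (integer part), there exist constants $0<c<C$ independent of $\beta$ such that $\frac c\beta\le N\le\frac C\beta$. Furthermore, there exists a unique $\tilde\alpha_0$ with $0<\tilde\alpha_0\le 2\tilde\kappa$ such that $$\int_0^{\pi/2}\sqrt{\tilde\alpha_0^2+\sin^2y}\,dy=\tilde\kappa\pi,$$ and $$F_{\beta,\kappa}(\varphi_\beta)=-\frac{\tilde\alpha_0^2}{8\beta^2}+O_\beta\left(\frac1\beta\right).$$ Finally, letting $\tilde\varphi_\beta(x):=\varphi_\beta(\beta x)$ for $x\in[0,1/\beta]$, $\tilde\varphi_\beta$ converges in $\mathcal C^\infty(K)$ for every compact $K\subset[0,+\infty)$ to the solution $\varphi_0$ of $$\varphi_0''=\sin\varphi_0\cos\varphi_0\ \text{in }\mathbb R^+,\qquad \varphi_0(0)=0,\qquad \varphi_0'(0)=\tilde\alpha_0.$$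
   Context: For parameters $\beta>0$ and $\kappa>0$ define, for $\varphi\in H^1((0,1))$, $$F_{\beta,\kappa}(\varphi)=\frac18\int_0^1\left(\varphi'(x)^2+\frac{1}{\beta^2}\sin^2\varphi(x)\right)dx-\frac{\kappa}{2}\int_0^1\varphi'(x)\,dx,$$ and $\mathcal J=\{\varphi\in H^1((0,1)):\varphi(0)=0\}$. $E(\cdot)$ denotes the integer part. The notations $o_\beta$, $O_\beta$ refer to the limit $\beta\to0$. *)

theory Defs
  imports "HOL-Analysis.Analysis"
begin

text \<open>H^1((0,1)): phi is (on [0,1]) the continuous representative, g a weak derivative in L^2(0,1),
  i.e. phi x = phi 0 + int_0^x g for x in [0,1]. Values outside [0,1] are irrelevant.\<close>
definition H1 :: "(real \<Rightarrow> real) \<Rightarrow> (real \<Rightarrow> real) \<Rightarrow> bool" where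
  "H1 \<phi> g \<longleftrightarrow>
     set_integrable lborel {0..1} g \<and>
     set_integrable lborel {0..1} (\<lambda>x. (g x)\<^sup>2) \<and>
     (\<forall>x\<in>{0..1}. \<phi> x = \<phi> 0 + (LBINT t=0..x. g t))"

definition F :: "real \<Rightarrow> real \<Rightarrow> (real \<Rightarrow> real) \<Rightarrow> (real \<Rightarrow> real) \<Rightarrow> real" where
  "F \<beta> \<kappa> \<phi> g =
     (1/8) * (LBINT x=0..1. (g x)\<^sup>2 + (1 / \<beta>\<^sup>2) * (sin (\<phi> x))\<^sup>2)
     - (\<kappa> / 2) * (LBINT x=0..1. g x)"

definition in_J :: "(real \<Rightarrow> real) \<Rightarrow> (real \<Rightarrow> real) \<Rightarrow> bool" where
  "in_J \<phi> g \<longleftrightarrow> H1 \<phi> g \<and> \<phi> 0 = 0"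

definition is_minimizer :: "real \<Rightarrow> real \<Rightarrow> (real \<Rightarrow> real) \<Rightarrow> (real \<Rightarrow> real) \<Rightarrow> bool" where
  "is_minimizer \<beta> \<kappa> \<phi> g \<longleftrightarrow>
     in_J \<phi> g \<and> (\<forall>\<psi> h. in_J \<psi> h \<longrightarrow> F \<beta> \<kappa> \<phi> g \<le> F \<beta> \<kappa> \<psi> h)"

definition smooth_derivs :: "real set \<Rightarrow> (real \<Rightarrow> real) \<Rightarrow> (nat \<Rightarrow> real \<Rightarrow> real) \<Rightarrow> bool" where
  "smooth_derivs S f D \<longleftrightarrow>
     (\<forall>x\<in>S. D 0 x = f x) \<and>
     (\<forall>k. \<forall>x\<in>S. (D k has_real_derivative D (Suc k) x) (at x within S))"

end

theory Submission
  imports Defs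
begin

text \<open>
  For \<open>a > 0\<close> let \<open>speed a y = sqrt (a\<^sup>2 + sin\<^sup>2 y)\<close> and let \<open>action a\<close> be its primitive. Completing the
  square gives, for every \<open>\<phi>\<close> in the class and every \<open>a > 0\<close>,
  \<open>8 F(\<phi>) = \<integral> (\<phi>' - speed a \<phi> / \<beta>)\<^sup>2 + 2 (action a (\<phi> 1) - 2 \<kappa>t \<phi> 1) / \<beta> - a\<^sup>2 / \<beta>\<^sup>2\<close>.

  If \<open>\<phi>\<close> is a minimizer with \<open>\<phi> 1 > 0\<close>, choose \<open>a\<close> such that the solution of \<open>\<psi>' = speed a \<psi> / \<beta>\<close>,
  \<open>\<psi> 0 = 0\<close>, satisfies \<open>\<psi> 1 = \<phi> 1\<close>. Comparing with \<open>\<psi>\<close> shows that the square vanishes, so \<open>\<phi> = \<psi>\<close>.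
  For the critical parameter \<open>a = a0\<close> the function \<open>y \<mapsto> action a y - 2 \<kappa>t y\<close> is periodic, hence bounded.
  This gives the energy up to \<open>O(1 / \<beta>)\<close>, and it bounds the square for \<open>a0\<close> by \<open>O(1 / \<beta>)\<close>,
  which forces \<open>(a - a0)\<^sup>2 = O(\<beta>)\<close>. Everything else follows from the explicit form of \<open>\<psi>\<close> as the
  inverse of a primitive of \<open>1 / speed a\<close> and its continuous dependence on \<open>a\<close>.
\<close>

subsection \<open>Primitives of continuous functions\<close>

text \<open>Characterised by its derivative on the whole line and normalised at 0, so that negative
  arguments need no signed integrals.\<close>

definition primitive :: "(real \<Rightarrow> real) \<Rightarrow> real \<Rightarrow> real" where
  "primitive f = (SOME F. F 0 = 0 \<and> (\<forall>x. DERIV F x :> f x))"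

lemma primitive:
  assumes "continuous_on UNIV f"
  shows primitive_0: "primitive f 0 = 0" and DERIV_primitive: "DERIV (primitive f) x :> f x"
proof -
  have "\<exists>F. \<forall>x::real. -\<infinity> < ereal x \<longrightarrow> ereal x < \<infinity> \<longrightarrow> (F has_vector_derivative f x) (at x)"
    using assms by (intro einterval_antiderivative) (auto simp: continuous_on_eq_continuous_at)
  then obtain F where F: "\<And>x. (F has_vector_derivative f x) (at x)" by auto
  have "(\<lambda>x. F x - F 0) 0 = 0 \<and> (\<forall>x. DERIV (\<lambda>x. F x - F 0) x :> f x)"
    using F by (auto simp flip: has_real_derivative_iff_has_vector_derivative intro!: derivative_eq_intros)
  then have "primitive f 0 = 0 \<and> (\<forall>x. DERIV (primitive f) x :> f x)"
    unfolding primitive_def by (rule someI[where P = "\<lambda>F. F 0 = 0 \<and> (\<forall>x. DERIV F x :> f x)"])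
  then show "primitive f 0 = 0" "DERIV (primitive f) x :> f x" by auto
qed

lemma primitive_add_period:
  assumes f: "continuous_on UNIV f" and per: "\<And>y. f (y + p) = f y"
  shows "primitive f (y + p) = primitive f y + primitive f p"
proof -
  have "\<forall>y. DERIV (\<lambda>y. primitive f (y + p) - primitive f y) y :> 0"
    by (auto intro!: derivative_eq_intros DERIV_chain'[OF _ DERIV_primitive[OF f]] DERIV_primitive[OF f] simp: per)
  from DERIV_isconst_all[OF this, of y 0] show ?thesis using primitive_0[OF f] by simp
qed

text \<open>By symmetry the derivatives of \<open>primitive f (p - y)\<close> and
  \<open>primitive f y\<close> cancel, so their sum takes the same value at \<open>p / 2\<close> and
  at 0.\<close>

lemma primitive_reflect:
  assumes f: "continuous_on UNIV f" and sym: "\<And>y. f (p - y) = f y"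
  shows "primitive f p = 2 * primitive f (p / 2)"
proof -
  have "\<forall>y. DERIV (\<lambda>y. primitive f (p - y) + primitive f y) y :> 0"
    by (auto intro!: derivative_eq_intros DERIV_chain'[OF _ DERIV_primitive[OF f]] DERIV_primitive[OF f] simp: sym)
  from DERIV_isconst_all[OF this, of "p/2" 0] show ?thesis using primitive_0[OF f] by simp
qed

text \<open>Mean value inequality for the difference of the two primitives. It carries pointwise
  dependence on the parameter over to the travel time and the action.\<close>

lemma abs_primitive_diff_le:
  assumes f: "continuous_on UNIV f" and h: "continuous_on UNIV h"
    and le: "\<And>y. \<bar>f y - h y\<bar> \<le> B"
  shows "\<bar>(primitive f u - primitive f v) - (primitive h u - primitive h v)\<bar> \<le> B * \<bar>u - v\<bar>"
proof -
  have "norm ((primitive f u - primitive h u) - (primitive f v - primitive h v)) \<le> B * norm (u - v)"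
    by (rule field_differentiable_bound[of UNIV _ "\<lambda>y. f y - h y"])
      (auto intro!: derivative_eq_intros DERIV_primitive f h le)
  then show ?thesis by (simp add: algebra_simps)
qed

lemma primitive_diff_ge:
  assumes f: "continuous_on UNIV f" and ge: "\<And>y. c \<le> f y" and "u \<le> v"
  shows "c * (v - u) \<le> primitive f v - primitive f u"
proof (cases "u = v")
  case False
  then obtain z where "primitive f v - primitive f u = (v - u) * f z"
    using MVT2[of u v "primitive f" f] DERIV_primitive[OF f] \<open>u \<le> v\<close> by auto
  then show ?thesis using ge[of z] \<open>u \<le> v\<close> by (simp add: mult.commute mult_right_mono)
qed simp

subsection \<open>Orbits\<close>

definition speed :: "real \<Rightarrow> real \<Rightarrow> real" where
  "speed a y = sqrt (a\<^sup>2 + (sin y)\<^sup>2)"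

lemma speed_sq: "(speed a y)\<^sup>2 = a\<^sup>2 + (sin y)\<^sup>2"
  by (simp add: speed_def)

lemma speed_ge: "0 < a \<Longrightarrow> a \<le> speed a y"
  unfolding speed_def by (intro real_le_rsqrt) simp

lemma speed_le: "0 < a \<Longrightarrow> speed a y \<le> a + \<bar>sin y\<bar>"
  unfolding speed_def by (intro real_le_lsqrt) (auto simp: power2_sum)

lemma speed_le_add_1: "0 < a \<Longrightarrow> speed a y \<le> a + 1"
  using speed_le[of a y] abs_sin_le_one[of y] by linarith

lemma speed_pos: "0 < a \<Longrightarrow> 0 < speed a y"
  using speed_ge[of a y] by linarith

lemma continuous_on_speed [continuous_intros]:
  fixes f :: "'a::t2_space \<Rightarrow> real"
  shows "continuous_on S f \<Longrightarrow> continuous_on S (\<lambda>x. speed a (f x))"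
  unfolding speed_def by (intro continuous_intros)

lemma speed_add_pi [simp]: "speed a (y + pi) = speed a y"
  and speed_pi_diff [simp]: "speed a (pi - y) = speed a y"
  by (simp_all add: speed_def)

text \<open>Reverse triangle inequality for the Euclidean norm of the plane, which is at most the
  sum of the absolute values of the coordinates.\<close>

lemma abs_sqrt_sum_squares_diff: "\<bar>sqrt (a\<^sup>2 + s\<^sup>2) - sqrt (b\<^sup>2 + t\<^sup>2)\<bar> \<le> \<bar>a - b\<bar> + \<bar>s - t\<bar>" for a b s t :: real
proof -
  have "\<bar>norm (a, s) - norm (b, t)\<bar> \<le> norm ((a, s) - (b, t))" by (rule norm_triangle_ineq3)
  also have "\<dots> \<le> \<bar>a - b\<bar> + \<bar>s - t\<bar>" by (simp add: norm_Pair sqrt_sum_squares_le_sum_abs)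
  finally show ?thesis by (simp add: norm_Pair)
qed

lemma abs_sin_diff_le: "\<bar>sin x - sin y\<bar> \<le> \<bar>x - y\<bar>" for x y :: real
  using field_differentiable_bound[of UNIV sin cos 1 x y] by (auto intro!: derivative_eq_intros)

lemma abs_cos_diff_le: "\<bar>cos x - cos y\<bar> \<le> \<bar>x - y\<bar>" for x y :: real
  using abs_sin_diff_le[of "pi / 2 - x" "pi / 2 - y"] by (simp add: sin_diff abs_minus_commute)

lemma abs_speed_diff_le: "\<bar>speed a x - speed b y\<bar> \<le> \<bar>a - b\<bar> + \<bar>x - y\<bar>"
  using abs_sqrt_sum_squares_diff[of a "sin x" b "sin y"] abs_sin_diff_le[of x y] by (simp add: speed_def)

lemma DERIV_speed: "0 < a \<Longrightarrow> DERIV (speed a) y :> sin y * cos y / speed a y"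
  using speed_pos[of a y] unfolding speed_def real_sqrt_gt_0_iff
  by (auto intro!: derivative_eq_intros simp: divide_simps)

lemma continuous_speed: "continuous_on UNIV (speed a)"
  by (intro continuous_intros continuous_on_id)

lemma continuous_inverse_speed: "0 < a \<Longrightarrow> continuous_on UNIV (\<lambda>y. 1 / speed a y)"
  using speed_pos[of a] by (intro continuous_intros) (auto simp: less_imp_neq[symmetric])

section \<open>Travel time and its inverse\<close>

definition travel_time :: "real \<Rightarrow> real \<Rightarrow> real" where
  "travel_time a = primitive (\<lambda>y. 1 / speed a y)"

text \<open>Separation of variables: this is the solution \<open>P\<close> of \<open>P' = speed a P\<close>, \<open>P 0 = 0\<close>.\<close>
definition orbit :: "real \<Rightarrow> real \<Rightarrow> real" where
  "orbit a = inv (travel_time a)"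

lemma travel_time_0 [simp]: "0 < a \<Longrightarrow> travel_time a 0 = 0"
  unfolding travel_time_def by (intro primitive_0 continuous_inverse_speed)

lemma DERIV_travel_time: "0 < a \<Longrightarrow> DERIV (travel_time a) y :> 1 / speed a y"
  unfolding travel_time_def by (intro DERIV_primitive continuous_inverse_speed)

lemma travel_time_add_pi: "0 < a \<Longrightarrow> travel_time a (y + pi) = travel_time a y + travel_time a pi"
  unfolding travel_time_def by (intro primitive_add_period continuous_inverse_speed) auto

lemma travel_time_diff_ge:
  assumes "0 < a" "u \<le> v"
  shows "(v - u) / (a + 1) \<le> travel_time a v - travel_time a u"
  using primitive_diff_ge[OF continuous_inverse_speed[OF assms(1)], of "1 / (a + 1)" u v]
    assms speed_le_add_1[of a] speed_pos[of a]
  by (simp add: travel_time_def frac_le)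

text \<open>The integrand \<open>1 / speed a\<close> is at least \<open>1 / (a + 1)\<close>, so an
  inverse is Lipschitz with constant \<open>a + 1\<close>. Injectivity of the travel time and
  continuity of the orbit follow from this.\<close>

lemma abs_travel_time_diff_ge:
  assumes "0 < a"
  shows "\<bar>u - v\<bar> \<le> (a + 1) * \<bar>travel_time a u - travel_time a v\<bar>"
proof -
  have *: "v - u \<le> (a + 1) * \<bar>travel_time a v - travel_time a u\<bar>" if "u \<le> v" for u v
  proof -
    have "(v - u) / (a + 1) \<le> \<bar>travel_time a v - travel_time a u\<bar>"
      using travel_time_diff_ge[OF assms that] by linarith
    then show ?thesis using assms by (simp add: pos_divide_le_eq mult.commute)
  qed
  show ?thesis using *[of u v] *[of v u] by (cases "u \<le> v") (auto simp: abs_minus_commute)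
qed

lemma abs_travel_time_le:
  assumes "0 < a"
  shows "\<bar>travel_time a u\<bar> \<le> \<bar>u\<bar> / a"
proof -
  have "norm (travel_time a u - travel_time a 0) \<le> 1 / a * norm (u - 0)"
    using assms speed_ge[OF assms] speed_pos[OF assms]
    by (intro field_differentiable_bound[of UNIV _ "\<lambda>y. 1 / speed a y"])
      (auto intro!: DERIV_travel_time frac_le simp: abs_of_pos)
  then show ?thesis using assms by simp
qed

lemma travel_time_orbit:
  assumes "0 < a" shows "travel_time a (orbit a x) = x"
proof -
  have "x \<in> range (travel_time a)"
  proof -
    \<comment> \<open>Growth at rate at least \<open>1 / (a + 1)\<close> makes the values at
      \<open>- ?r\<close> and \<open>?r\<close> enclose \<open>x\<close>.\<close>
    let ?r = "(a + 1) * \<bar>x\<bar>"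
    have "x \<le> travel_time a ?r" "travel_time a (- ?r) \<le> x"
      using travel_time_diff_ge[OF assms, of 0 ?r] travel_time_diff_ge[OF assms, of "- ?r" 0] assms
      by (auto simp: mult_less_0_iff)
    moreover have "continuous_on {-?r..?r} (travel_time a)"
      using DERIV_isCont[OF DERIV_travel_time[OF assms]] by (auto intro: continuous_at_imp_continuous_on)
    moreover have "- ?r \<le> ?r" using assms by auto
    ultimately obtain y where "travel_time a y = x"
      using IVT'[of "travel_time a" "-?r" x ?r] by blast
    then show ?thesis by auto
  qed
  then show ?thesis unfolding orbit_def by (rule f_inv_into_f)
qed

lemma travel_time_inj: "0 < a \<Longrightarrow> travel_time a u = travel_time a v \<Longrightarrow> u = v"
  using abs_travel_time_diff_ge[of a u v] by simp

lemma orbit_unique: "0 < a \<Longrightarrow> travel_time a u = x \<Longrightarrow> orbit a x = u"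
  by (metis travel_time_inj travel_time_orbit)

lemma orbit_0 [simp]: "0 < a \<Longrightarrow> orbit a 0 = 0"
  by (simp add: orbit_unique)

lemma abs_orbit_diff_le: "0 < a \<Longrightarrow> \<bar>orbit a x - orbit a y\<bar> \<le> (a + 1) * \<bar>x - y\<bar>"
  using abs_travel_time_diff_ge[of a "orbit a x" "orbit a y"] by (simp add: travel_time_orbit)

lemma isCont_orbit: assumes "0 < a" shows "isCont (orbit a) x"
proof -
  have "(a + 1)-lipschitz_on UNIV (orbit a)"
    using assms by (intro lipschitz_onI) (auto simp: dist_real_def abs_orbit_diff_le)
  then show ?thesis
    using lipschitz_on_continuous_on continuous_on_eq_continuous_at open_UNIV UNIV_I by metis
qed

lemma DERIV_orbit:
  assumes "0 < a" shows "DERIV (orbit a) x :> speed a (orbit a x)"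
  using DERIV_inverse_function[OF DERIV_travel_time[OF assms], of "orbit a" x "x - 1" "x + 1"]
    isCont_orbit[OF assms] speed_pos[OF assms, of "orbit a x"] travel_time_orbit[OF assms]
  by (simp add: inverse_eq_divide)

text \<open>\<open>travel_time a pi\<close> is the time in which the position advances by
  \<open>pi\<close>; multiplied by \<beta> it becomes the \<open>T\<close> of the theorem.\<close>

lemma orbit_add_period:
  "0 < a \<Longrightarrow> orbit a (x + travel_time a pi) = orbit a x + pi"
  by (intro orbit_unique) (auto simp: travel_time_add_pi travel_time_orbit)

text \<open>The factor \<open>speed a\<close> cancels in the chain rule, so the first-order equation
  \<open>P' = speed a P\<close> yields \<open>P'' = sin P cos P\<close>.\<close>

lemma DERIV_speed_orbit:
  assumes "0 < a" shows "DERIV (\<lambda>x. speed a (orbit a x)) x :> sin (orbit a x) * cos (orbit a x)"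
  using DERIV_chain2[OF DERIV_speed[OF assms] DERIV_orbit[OF assms], of x] speed_pos[OF assms, of "orbit a x"]
  by simp

section \<open>Dependence of travel time and orbit on the parameter\<close>

lemma travel_time_dependence:
  assumes "0 < a" "0 < b"
  shows "\<bar>travel_time a u - travel_time b u\<bar> \<le> \<bar>a - b\<bar> / (a * b) * \<bar>u\<bar>"
proof -
  have "\<bar>1 / speed a y - 1 / speed b y\<bar> \<le> \<bar>a - b\<bar> / (a * b)" for y
  proof -
    have "\<bar>1 / speed a y - 1 / speed b y\<bar> = \<bar>speed a y - speed b y\<bar> / (speed a y * speed b y)"
      using speed_pos[OF assms(1), of y] speed_pos[OF assms(2), of y]
      by (simp add: diff_frac_eq abs_mult abs_minus_commute)
    also have "\<dots> \<le> \<bar>a - b\<bar> / (a * b)"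
      using abs_speed_diff_le[of a y b y] speed_ge[OF assms(1), of y] speed_ge[OF assms(2), of y] assms
      by (intro frac_le mult_mono) auto
    finally show ?thesis .
  qed
  then show ?thesis
    using abs_primitive_diff_le[OF continuous_inverse_speed continuous_inverse_speed, OF assms, of "\<bar>a - b\<bar> / (a * b)" u 0]
      travel_time_0[OF assms(1)] travel_time_0[OF assms(2)]
    by (auto simp: travel_time_def)
qed

text \<open>The distance is measured by \<open>travel_time a\<close>. As both orbits are taken at
  their own time \<open>x\<close>, it reduces to the difference of the two travel times at the
  single point \<open>orbit b x\<close>.\<close>

lemma orbit_dependence:
  assumes "0 < a" "0 < b"
  shows "\<bar>orbit a x - orbit b x\<bar> \<le> (a + 1) * (\<bar>a - b\<bar> / (a * b)) * ((b + 1) * \<bar>x\<bar>)"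
proof -
  have "\<bar>orbit a x - orbit b x\<bar> \<le> (a + 1) * \<bar>travel_time a (orbit a x) - travel_time a (orbit b x)\<bar>"
    by (rule abs_travel_time_diff_ge[OF assms(1)])
  also have "\<dots> = (a + 1) * \<bar>travel_time a (orbit b x) - travel_time b (orbit b x)\<bar>"
    using assms by (simp add: travel_time_orbit abs_minus_commute)
  also have "\<dots> \<le> (a + 1) * (\<bar>a - b\<bar> / (a * b) * \<bar>orbit b x\<bar>)"
    using travel_time_dependence[OF assms] assms by (intro mult_left_mono) auto
  also have "\<dots> \<le> (a + 1) * (\<bar>a - b\<bar> / (a * b) * ((b + 1) * \<bar>x\<bar>))"
    using abs_orbit_diff_le[OF assms(2), of x 0] assms by (intro mult_left_mono) auto
  finally show ?thesis by (simp add: mult.assoc)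
qed

text \<open>Intermediate value theorem in the parameter: \<open>a = A / L\<close> is fast enough
  because \<open>1 / speed a \<le> 1 / a\<close>, and a small \<open>a\<close> is slow enough
  because the travel time then grows logarithmically. This allows an orbit to be aimed at a
  prescribed end point.\<close>

lemma travel_time_surj:
  assumes "0 < A" "0 < L"
  obtains a where "0 < a" "travel_time a A = L"
proof -
  \<comment> \<open>Solves \<open>ln (1 + A / lo) = L\<close>; the left side will be a lower bound
    for \<open>travel_time lo A\<close>.\<close>
  define lo where "lo = A / (exp L - 1)"
  have lo: "0 < lo" using assms by (simp add: lo_def)
  have "lo \<le> A / L"
  proof -
    have "L \<le> exp L - 1" using exp_ge_add_one_self[of L] by linarith
    then show ?thesis unfolding lo_def using assms by (intro divide_left_mono mult_pos_pos) auto
  qed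
  have up: "travel_time (A / L) A \<le> L"
    using abs_travel_time_le[of "A / L" A] assms by auto
  have "ln (1 + A / lo) \<le> travel_time lo A"
  proof -
    \<comment> \<open>Comparison with \<open>ln (lo + y)\<close>, whose derivative
      \<open>1 / (lo + y)\<close> lies below \<open>1 / speed lo y\<close> for positive
      \<open>y\<close>.\<close>
    have "\<exists>z>0. z < A \<and> (travel_time lo A - ln (lo + A)) - (travel_time lo 0 - ln (lo + 0)) = (A - 0) * (1 / speed lo z - 1 / (lo + z))"
      using assms lo by (intro MVT2) (auto intro!: derivative_eq_intros DERIV_travel_time)
    then obtain z where z: "0 < z" "z < A" "travel_time lo A - ln (lo + A) + ln lo = A * (1 / speed lo z - 1 / (lo + z))"
      using lo by auto
    have "speed lo z \<le> lo + z" using speed_le[OF lo, of z] abs_sin_x_le_abs_x[of z] z by auto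
    then have "0 \<le> A * (1 / speed lo z - 1 / (lo + z))"
      using speed_pos[OF lo, of z] assms by (auto intro!: mult_nonneg_nonneg simp: frac_le)
    then have "ln (lo + A) - ln lo \<le> travel_time lo A" using z by linarith
    moreover have "ln (1 + A / lo) = ln (lo + A) - ln lo"
    proof -
      have "1 + A / lo = (lo + A) / lo" using lo by (simp add: add_divide_distrib)
      then show ?thesis using lo assms by (simp add: ln_div)
    qed
    ultimately show ?thesis by simp
  qed
  moreover have "1 + A / lo = exp L" using assms by (simp add: lo_def)
  ultimately have low: "L \<le> travel_time lo A" by simp
  have "continuous_on {lo..A/L} (\<lambda>a. travel_time a A)"
  proof (rule continuous_on_subset)
    have "((\<lambda>b. travel_time b A) \<longlongrightarrow> travel_time a A) (at a)" if "0 < a" for a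
    proof (rule LIM_zero_cancel, rule Lim_null_comparison)
      show "\<forall>\<^sub>F b in at a. norm (travel_time b A - travel_time a A) \<le> \<bar>b - a\<bar> / (b * a) * \<bar>A\<bar>"
        using eventually_at_in_open'[of "{0<..}" a] that travel_time_dependence[of _ a A]
        by (auto elim!: eventually_mono)
      show "((\<lambda>b. \<bar>b - a\<bar> / (b * a) * \<bar>A\<bar>) \<longlongrightarrow> 0) (at a)"
        using that by (auto intro!: tendsto_eq_intros)
    qed
    then show "continuous_on {0<..} (\<lambda>a. travel_time a A)"
      by (auto intro!: continuous_at_imp_continuous_on simp: isCont_def)
    show "{lo..A / L} \<subseteq> {0<..}" using lo by auto
  qed
  then obtain a where "lo \<le> a" "travel_time a A = L"
    using IVT2'[of "\<lambda>a. travel_time a A" "A / L" L lo] up low \<open>lo \<le> A / L\<close> by auto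
  with lo that[of a] show ?thesis by auto
qed

subsection \<open>The calibration identity\<close>

text \<open>Pointwise differentiation of \<open>\<phi>\<close> is avoided. The defect
  \<open>H\<close> between the two sides changes over an interval by at most a constant times the
  square of the integral of \<open>\<bar>g\<bar>\<close> there; summed over finer and finer
  partitions these changes tend to 0.\<close>

lemma chain_rule_indefinite_integral:
  fixes g \<phi> f W :: "real \<Rightarrow> real"
  assumes g: "g absolutely_integrable_on {a..b}" and "a \<le> b"
    and \<phi>: "\<And>x. x \<in> {a..b} \<Longrightarrow> \<phi> x = \<phi> a + integral {a..x} g"
    and W: "\<And>y. DERIV W y :> f y" and f: "K-lipschitz_on UNIV f"
  shows "(\<lambda>x. g x * f (\<phi> x)) absolutely_integrable_on {a..b}"
    and "integral {a..b} (\<lambda>x. g x * f (\<phi> x)) = W (\<phi> b) - W (\<phi> a)"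
proof -
  have gi: "g integrable_on {x..y}" and ni: "(\<lambda>t. \<bar>g t\<bar>) integrable_on {x..y}" if "a \<le> x" "y \<le> b" for x y
    using absolutely_integrable_on_subinterval[OF g, of x y] that
    by (auto simp: absolutely_integrable_on_def)
  have cont_\<phi>: "continuous_on {a..b} \<phi>"
    by (rule continuous_on_eq[OF _ \<phi>[symmetric]])
      (intro continuous_on_add continuous_on_const indefinite_integral_continuous_1 gi order_refl)
  have cont_f: "continuous_on UNIV f" using f by (rule lipschitz_on_continuous_on)
  have cf: "continuous_on {a..b} (\<lambda>x. f (\<phi> x))"
    by (rule continuous_on_compose2[OF cont_f cont_\<phi>]) auto
  have "(\<lambda>x. f (\<phi> x) * g x) absolutely_integrable_on {a..b}"
    using g cf compact_imp_bounded[OF compact_continuous_image[OF cf compact_Icc]]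
    by (intro absolutely_integrable_bounded_measurable_product_real)
      (auto intro: continuous_imp_measurable_on_sets_lebesgue)
  then show gf: "(\<lambda>x. g x * f (\<phi> x)) absolutely_integrable_on {a..b}" by (simp add: mult.commute)
  have gfi: "(\<lambda>x. g x * f (\<phi> x)) integrable_on {x..y}" if "a \<le> x" "y \<le> b" for x y
    using absolutely_integrable_on_subinterval[OF gf, of x y] that
    by (auto simp: absolutely_integrable_on_def)
  \<comment> \<open>\<open>\<mu>\<close> accumulates \<open>\<bar>g\<bar>\<close> and dominates the
    increments of \<open>\<phi>\<close>; the goal is that \<open>H\<close> agrees at both end
    points.\<close>
  define \<mu> where "\<mu> x = integral {a..x} (\<lambda>t. \<bar>g t\<bar>)" for x
  define H where "H x = W (\<phi> x) - integral {a..x} (\<lambda>t. g t * f (\<phi> t))" for x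
  have K: "0 \<le> K" using f by (rule lipschitz_on_nonneg)
  have \<mu>_diff: "integral {x..y} (\<lambda>t. \<bar>g t\<bar>) = \<mu> y - \<mu> x" if "a \<le> x" "x \<le> y" "y \<le> b" for x y
    using Henstock_Kurzweil_Integration.integral_combine[OF that(1,2) ni[of a y]] that by (simp add: \<mu>_def)
  have \<phi>_diff: "\<phi> y - \<phi> x = integral {x..y} g" if "a \<le> x" "x \<le> y" "y \<le> b" for x y
    using Henstock_Kurzweil_Integration.integral_combine[OF that(1,2) gi[of a y]] that \<phi>[of x] \<phi>[of y] by simp
  have \<phi>_le: "\<bar>\<phi> y - \<phi> x\<bar> \<le> \<mu> y - \<mu> x" if "a \<le> x" "x \<le> y" "y \<le> b" for x y
    using integral_norm_bound_integral[OF gi[of x y] ni[of x y]] that \<phi>_diff[OF that] \<mu>_diff[OF that] by simp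
  have lip: "\<bar>f u - f v\<bar> \<le> K * \<bar>u - v\<bar>" for u v
    using lipschitz_onD[OF f, of u v] by (simp add: dist_real_def)
  have H_le: "\<bar>H y - H x\<bar> \<le> 2 * K * (\<mu> y - \<mu> x)\<^sup>2" if xy: "a \<le> x" "x \<le> y" "y \<le> b" for x y
  proof -
    let ?m = "\<mu> y - \<mu> x"
    have m: "0 \<le> ?m" using \<phi>_le[OF xy] by linarith
    \<comment> \<open>Freezing \<open>f\<close> at \<open>\<phi> x\<close>: the function
      \<open>W z - f (\<phi> x) * z\<close> has derivative at most \<open>K * ?m\<close> in absolute
      value on the segment. The integral is frozen in the same way next.\<close>
    have "norm ((W (\<phi> y) - f (\<phi> x) * \<phi> y) - (W (\<phi> x) - f (\<phi> x) * \<phi> x)) \<le> (K * ?m) * norm (\<phi> y - \<phi> x)"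
    proof (rule field_differentiable_bound[of "closed_segment (\<phi> x) (\<phi> y)" _ "\<lambda>z. f z - f (\<phi> x)"])
      fix z assume z: "z \<in> closed_segment (\<phi> x) (\<phi> y)"
      show "((\<lambda>z. W z - f (\<phi> x) * z) has_real_derivative f z - f (\<phi> x)) (at z within closed_segment (\<phi> x) (\<phi> y))"
        by (auto intro!: derivative_eq_intros has_field_derivative_at_within[OF W])
      have "\<bar>z - \<phi> x\<bar> \<le> ?m"
        using z \<phi>_le[OF xy] by (auto simp: closed_segment_eq_real_ivl split: if_splits)
      then show "norm (f z - f (\<phi> x)) \<le> K * ?m"
        using lip[of z "\<phi> x"] mult_left_mono[OF _ K] by fastforce
    qed auto
    also have "\<dots> \<le> K * ?m * ?m" using \<phi>_le[OF xy] K m by (auto intro: mult_left_mono)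
    finally have 1: "\<bar>W (\<phi> y) - W (\<phi> x) - f (\<phi> x) * (\<phi> y - \<phi> x)\<bar> \<le> K * ?m * ?m"
      by (simp add: algebra_simps)
    have "norm (integral {x..y} (\<lambda>t. g t * f (\<phi> t) - g t * f (\<phi> x))) \<le> integral {x..y} (\<lambda>t. \<bar>g t\<bar> * (K * ?m))"
    proof (rule integral_norm_bound_integral)
      show "(\<lambda>t. g t * f (\<phi> t) - g t * f (\<phi> x)) integrable_on {x..y}"
        using xy by (intro integrable_diff gfi integrable_on_mult_left gi) auto
      show "(\<lambda>t. \<bar>g t\<bar> * (K * ?m)) integrable_on {x..y}"
        using xy by (intro integrable_on_mult_left ni) auto
      fix t assume t: "t \<in> {x..y}"
      have "0 \<le> \<mu> y - \<mu> t" using \<phi>_le[of t y] t xy by auto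
      then have "\<bar>\<phi> t - \<phi> x\<bar> \<le> ?m" using \<phi>_le[of x t] t xy by auto
      then have "\<bar>f (\<phi> t) - f (\<phi> x)\<bar> \<le> K * ?m"
        using lip[of "\<phi> t" "\<phi> x"] mult_left_mono[OF _ K] by fastforce
      then show "norm (g t * f (\<phi> t) - g t * f (\<phi> x)) \<le> \<bar>g t\<bar> * (K * ?m)"
        by (simp add: abs_mult mult_left_mono flip: right_diff_distrib)
    qed
    also have "\<dots> = K * ?m * ?m" using \<mu>_diff[OF xy] by simp
    also have "integral {x..y} (\<lambda>t. g t * f (\<phi> t) - g t * f (\<phi> x)) =
        integral {x..y} (\<lambda>t. g t * f (\<phi> t)) - f (\<phi> x) * (\<phi> y - \<phi> x)"
      using xy by (subst Henstock_Kurzweil_Integration.integral_diff)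
        (auto intro!: gfi integrable_on_mult_left gi simp: \<phi>_diff)
    also have "integral {x..y} (\<lambda>t. g t * f (\<phi> t)) =
        integral {a..y} (\<lambda>t. g t * f (\<phi> t)) - integral {a..x} (\<lambda>t. g t * f (\<phi> t))"
      using Henstock_Kurzweil_Integration.integral_combine[OF xy(1,2) gfi[of a y]] xy by simp
    finally show ?thesis using 1 unfolding H_def power2_eq_square real_norm_def mult.assoc by linarith
  qed
  have H_le': "\<bar>H y - H x\<bar> \<le> 2 * K * (\<mu> y - \<mu> x)\<^sup>2" if "x \<in> {a..b}" "y \<in> {a..b}" for x y
    using H_le[of x y] H_le[of y x] that by (cases "x \<le> y") (auto simp: abs_minus_commute power2_commute)
  have M: "0 \<le> \<mu> b" using \<phi>_le[of a b] \<open>a \<le> b\<close> by (simp add: \<mu>_def)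
  \<comment> \<open>Partition points are placed at equal increments of \<open>\<mu>\<close> instead
    of equal lengths, so all pieces carry the same error, quadratic in the increment.\<close>
  have "\<exists>p\<in>{a..b}. \<mu> p = s" if "0 \<le> s" "s \<le> \<mu> b" for s
    using IVT'[of \<mu> a s b] that \<open>a \<le> b\<close> indefinite_integral_continuous_1[OF ni[of a b]]
    by (force simp: \<mu>_def)
  then obtain p where p: "\<And>s. 0 \<le> s \<Longrightarrow> s \<le> \<mu> b \<Longrightarrow> p s \<in> {a..b} \<and> \<mu> (p s) = s" by metis
  have small: "\<bar>H b - H a\<bar> \<le> 2 * K * (\<mu> b)\<^sup>2 / real (Suc n)" for n
  proof -
    let ?s = "\<lambda>i. \<mu> b * real i / real (Suc n)"
    have s: "0 \<le> ?s i" "?s i \<le> \<mu> b" if "i \<le> Suc n" for i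
      using that M mult_left_mono[of "real i" "real (Suc n)" "\<mu> b"] by (auto simp: pos_divide_le_eq)
    have "\<bar>H (p (?s i)) - H a\<bar> \<le> real i * (2 * K * (\<mu> b / real (Suc n))\<^sup>2)" if "i \<le> Suc n" for i
      using that
    proof (induction i)
      case 0
      then show ?case using H_le'[of a "p 0"] p[of 0] M \<open>a \<le> b\<close> by (simp add: \<mu>_def)
    next
      case (Suc i)
      have "?s (Suc i) - ?s i = \<mu> b / real (Suc n)"
        by (simp add: algebra_simps flip: diff_divide_distrib)
      then have "\<bar>H (p (?s (Suc i))) - H (p (?s i))\<bar> \<le> 2 * K * (\<mu> b / real (Suc n))\<^sup>2"
        using H_le'[of "p (?s i)" "p (?s (Suc i))"] p[OF s[of i]] p[OF s[of "Suc i"]] Suc.prems by simp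
      with Suc show ?case by (simp add: algebra_simps)
    qed
    from this[of "Suc n"] have "\<bar>H (p (\<mu> b)) - H a\<bar> \<le> real (Suc n) * (2 * K * (\<mu> b / real (Suc n))\<^sup>2)"
      by (simp del: of_nat_Suc)
    \<comment> \<open>The last partition point may differ from \<open>b\<close>, but
      \<open>\<mu>\<close> takes the same value at both, so \<open>H\<close> does too.\<close>
    moreover have "H b = H (p (\<mu> b))"
      using H_le'[of b "p (\<mu> b)"] p[of "\<mu> b"] M \<open>a \<le> b\<close> by simp
    moreover have "real (Suc n) * (2 * K * (\<mu> b / real (Suc n))\<^sup>2) = 2 * K * (\<mu> b)\<^sup>2 / real (Suc n)"
      by (simp add: power2_eq_square field_simps del: of_nat_Suc)
    ultimately show ?thesis by simp
  qed
  have "(\<lambda>n. 2 * K * (\<mu> b)\<^sup>2 / real (Suc n)) \<longlonglongrightarrow> 0"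
    by (rule LIMSEQ_Suc) (rule lim_const_over_n)
  then have "\<bar>H b - H a\<bar> \<le> 0"
    by (rule LIMSEQ_le_const) (use small in auto)
  then show "integral {a..b} (\<lambda>x. g x * f (\<phi> x)) = W (\<phi> b) - W (\<phi> a)"
    by (simp add: H_def)
qed

section \<open>The action and the completed square\<close>

definition action :: "real \<Rightarrow> real \<Rightarrow> real" where
  "action a = primitive (speed a)"

lemma action_0 [simp]: "action a 0 = 0"
  by (simp add: action_def primitive_0 continuous_speed)

lemma DERIV_action: "DERIV (action a) y :> speed a y"
  by (simp add: action_def DERIV_primitive continuous_speed)

lemma lipschitz_speed: "1-lipschitz_on UNIV (speed a)"
  using abs_speed_diff_le[of a _ a] by (intro lipschitz_onI) (auto simp: dist_real_def)

text \<open>Translates the interval integrals over \<open>lborel\<close> into gauge integrals, for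
  which the chain rule above is stated.\<close>

lemma H1D:
  assumes "H1 \<phi> g"
  shows "g absolutely_integrable_on {0..1}" "(\<lambda>x. (g x)\<^sup>2) absolutely_integrable_on {0..1}"
    "\<And>x. x \<in> {0..1} \<Longrightarrow> \<phi> x = \<phi> 0 + integral {0..x} g"
    "continuous_on {0..1} \<phi>"
proof -
  have *: "set_integrable lborel {0..1} f \<Longrightarrow> f absolutely_integrable_on {0..1}" for f :: "real \<Rightarrow> real"
    unfolding set_integrable_def by (subst integrable_completion) auto
  show g: "g absolutely_integrable_on {0..1}" "(\<lambda>x. (g x)\<^sup>2) absolutely_integrable_on {0..1}"
    using assms * by (auto simp: H1_def)
  show \<phi>: "\<phi> x = \<phi> 0 + integral {0..x} g" if "x \<in> {0..1}" for x
  proof -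
    have "set_integrable lborel {0..x} g"
      using assms that by (auto simp: H1_def intro: set_integrable_subset)
    moreover have "\<phi> x = \<phi> 0 + (LBINT t=0..x. g t)" using assms that unfolding H1_def by blast
    ultimately show ?thesis
      using interval_integral_eq_integral[of 0 x g] that by (simp add: zero_ereal_def)
  qed
  show "continuous_on {0..1} \<phi>"
    by (rule continuous_on_eq[OF _ \<phi>[symmetric]])
      (intro continuous_on_add continuous_on_const indefinite_integral_continuous_1
        set_lebesgue_integral_eq_integral(1) g)
qed

lemma F_eq_integral:
  assumes "in_J \<phi> g"
  shows "F \<beta> \<kappa> \<phi> g =
    1/8 * integral {0..1} (\<lambda>x. (g x)\<^sup>2 + 1 / \<beta>\<^sup>2 * (sin (\<phi> x))\<^sup>2) - \<kappa> / 2 * \<phi> 1"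
proof -
  from assms have H: "H1 \<phi> g" "\<phi> 0 = 0" by (auto simp: in_J_def)
  have "set_integrable lborel {0..1} (\<lambda>x. (g x)\<^sup>2 + 1 / \<beta>\<^sup>2 * (sin (\<phi> x))\<^sup>2)"
  proof (rule set_integral_add)
    show "set_integrable lborel {0..1} (\<lambda>x. (g x)\<^sup>2)" using H by (simp add: H1_def)
    show "set_integrable lborel {0..1} (\<lambda>x. 1 / \<beta>\<^sup>2 * (sin (\<phi> x))\<^sup>2)"
      by (intro borel_integrable_atLeastAtMost' continuous_intros H1D(4)[OF H(1)])
  qed
  then show ?thesis
    using interval_integral_eq_integral[of 0 1] H H1D(3)[OF H(1), of 1]
    by (auto simp: F_def H1_def zero_ereal_def one_ereal_def)
qed

text \<open>Complete the square, using \<open>(speed a)\<^sup>2 = a\<^sup>2 + sin\<^sup>2\<close>; the cross term integrates exactly.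
  The parameter \<open>a\<close> does not occur on the left and may be chosen freely.\<close>
lemma F_calibration:
  assumes J: "in_J \<phi> g" and "0 < a" "0 < \<beta>"
  shows "(\<lambda>x. (g x - speed a (\<phi> x) / \<beta>)\<^sup>2) integrable_on {0..1}"
    and "8 * F \<beta> (k / \<beta>) \<phi> g = integral {0..1} (\<lambda>x. (g x - speed a (\<phi> x) / \<beta>)\<^sup>2)
      + 2 * (action a (\<phi> 1) - 2 * k * \<phi> 1) / \<beta> - a\<^sup>2 / \<beta>\<^sup>2"
proof -
  from J have H: "H1 \<phi> g" "\<phi> 0 = 0" by (auto simp: in_J_def)
  note D = H1D[OF H(1)]
  note chain = chain_rule_indefinite_integral[OF D(1) _ D(3) DERIV_action lipschitz_speed, of a, simplified]
  let ?e = "\<lambda>x. (g x)\<^sup>2 + 1 / \<beta>\<^sup>2 * (sin (\<phi> x))\<^sup>2" and ?c = "\<lambda>x. g x * speed a (\<phi> x)"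
  have e: "?e integrable_on {0..1}"
  proof (rule integrable_add)
    show "(\<lambda>x. (g x)\<^sup>2) integrable_on {0..1}" using D(2) by (rule set_lebesgue_integral_eq_integral(1))
    show "(\<lambda>x. 1 / \<beta>\<^sup>2 * (sin (\<phi> x))\<^sup>2) integrable_on {0..1}"
      by (intro integrable_continuous_real continuous_intros D(4))
  qed
  have c: "?c integrable_on {0..1}" using chain(1) by (simp add: absolutely_integrable_on_def)
  have sq: "(\<lambda>x. (g x - speed a (\<phi> x) / \<beta>)\<^sup>2) = (\<lambda>x. ?e x - 2 / \<beta> * ?c x + a\<^sup>2 / \<beta>\<^sup>2)"
    using \<open>0 < \<beta>\<close> by (auto simp: power2_diff power_divide speed_sq add_divide_distrib)
  show "(\<lambda>x. (g x - speed a (\<phi> x) / \<beta>)\<^sup>2) integrable_on {0..1}"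
    unfolding sq by (intro integrable_add integrable_diff e integrable_on_mult_right c) auto
  have "integral {0..1} (\<lambda>x. (g x - speed a (\<phi> x) / \<beta>)\<^sup>2)
      = integral {0..1} ?e - 2 / \<beta> * integral {0..1} ?c + a\<^sup>2 / \<beta>\<^sup>2"
    unfolding sq using has_integral_const_real[of "a\<^sup>2 / \<beta>\<^sup>2" 0 1]
    by (intro integral_unique has_integral_add has_integral_diff has_integral_mult_right integrable_integral e c) simp
  also have "integral {0..1} ?c = action a (\<phi> 1)" using chain(2) H(2) by simp
  finally show "8 * F \<beta> (k / \<beta>) \<phi> g = integral {0..1} (\<lambda>x. (g x - speed a (\<phi> x) / \<beta>)\<^sup>2)
      + 2 * (action a (\<phi> 1) - 2 * k * \<phi> 1) / \<beta> - a\<^sup>2 / \<beta>\<^sup>2"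
    unfolding F_eq_integral[OF J] using \<open>0 < \<beta>\<close> by (simp add: field_simps)
qed

text \<open>Makes the rescaled orbits available as competitors, by the fundamental theorem of
  calculus.\<close>

lemma orbit_in_J:
  assumes "0 < a" "0 < \<beta>"
  shows "in_J (\<lambda>x. orbit a (x / \<beta>)) (\<lambda>x. speed a (orbit a (x / \<beta>)) / \<beta>)"
proof -
  let ?\<psi> = "\<lambda>x. orbit a (x / \<beta>)" and ?h = "\<lambda>x. speed a (orbit a (x / \<beta>)) / \<beta>"
  have d: "DERIV ?\<psi> x :> ?h x" for x
    using DERIV_chain2[OF DERIV_orbit[OF assms(1)] DERIV_cdivide[OF DERIV_ident, where c = \<beta>], of x] by simp
  then have "continuous_on UNIV ?\<psi>"
    by (meson DERIV_isCont continuous_at_imp_continuous_on)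
  then have c: "continuous_on S ?h" "continuous_on S (\<lambda>x. (?h x)\<^sup>2)" for S
    using assms by (auto intro!: continuous_intros intro: continuous_on_subset)
  have "integral {0..x} ?h = ?\<psi> x - ?\<psi> 0" if "0 \<le> x" for x
    using that d
    by (intro integral_unique fundamental_theorem_of_calculus)
      (auto simp: has_field_derivative_at_within simp flip: has_real_derivative_iff_has_vector_derivative)
  then show ?thesis
    unfolding in_J_def H1_def
    using assms(1) interval_integral_eq_integral[OF _ borel_integrable_atLeastAtMost'[OF c(1)], of 0]
      borel_integrable_atLeastAtMost'[OF c(1)] borel_integrable_atLeastAtMost'[OF c(2)]
    by (simp add: zero_ereal_def)
qed

text \<open>Along its own orbit the square in the calibration identity vanishes identically, leaving
  the boundary term and the constant.\<close>

lemma F_orbit: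
  assumes "0 < a" "0 < \<beta>"
  shows "8 * F \<beta> (k / \<beta>) (\<lambda>x. orbit a (x / \<beta>)) (\<lambda>x. speed a (orbit a (x / \<beta>)) / \<beta>)
    = 2 * (action a (orbit a (1 / \<beta>)) - 2 * k * orbit a (1 / \<beta>)) / \<beta> - a\<^sup>2 / \<beta>\<^sup>2"
  using F_calibration(2)[OF orbit_in_J[OF assms] assms] by simp

subsection \<open>The critical parameter\<close>

lemma action_half_pi: "integral {0..pi/2} (\<lambda>y. sqrt (a\<^sup>2 + (sin y)\<^sup>2)) = action a (pi / 2)"
proof -
  have "(speed a has_integral action a (pi / 2) - action a 0) {0..pi/2}"
    by (intro fundamental_theorem_of_calculus)
      (auto simp: DERIV_action has_field_derivative_at_within simp flip: has_real_derivative_iff_has_vector_derivative)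
  then show ?thesis by (simp add: integral_unique flip: speed_def)
qed

lemma action_pi: "action a pi = 2 * action a (pi / 2)"
  unfolding action_def by (intro primitive_reflect continuous_speed) simp

lemma action_add_pi: "action a (y + pi) = action a y + action a pi"
  unfolding action_def by (intro primitive_add_period continuous_speed) simp

lemma action_strict_mono:
  assumes "0 \<le> a" "a < b" "0 < u"
  shows "action a u < action b u"
proof -
  obtain z where "action b u - action a u = u * (speed b z - speed a z)"
    using MVT2[of 0 u "\<lambda>y. action b y - action a y" "\<lambda>z. speed b z - speed a z"] \<open>0 < u\<close>
    by (auto intro: DERIV_diff DERIV_action)
  moreover have "speed a z < speed b z"
    using assms by (simp add: speed_def power_strict_mono)
  ultimately show ?thesis using \<open>0 < u\<close> by (metis diff_gt_0_iff_gt mult_pos_pos)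
qed

text \<open>At \<open>a = 0\<close> the speed degenerates to \<open>\<bar>sin y\<bar>\<close>. The
  resulting value 1 is the threshold behind the hypothesis \<open>1 / pi < k\<close>.\<close>

lemma action_zero_half_pi: "action 0 (pi / 2) = 1"
proof -
  \<comment> \<open>Since \<open>- cos\<close> is a primitive of \<open>sin\<close>, the derivative
    of \<open>action 0 y + cos y\<close> vanishes inside the interval.\<close>
  have "\<exists>z>0. z < pi / 2 \<and>
    (action 0 (pi/2) + cos (pi/2)) - (action 0 0 + cos 0) = (pi/2 - 0) * (speed 0 z - sin z)"
    by (rule MVT2) (auto intro!: derivative_eq_intros DERIV_action)
  then obtain z where z: "0 < z" "z < pi / 2"
    "(action 0 (pi/2) + cos (pi/2)) - (action 0 0 + cos 0) = (pi/2 - 0) * (speed 0 z - sin z)" by blast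
  then have "sin z > 0" by (intro sin_gt_zero) auto
  then have "speed 0 z = sin z" by (simp add: speed_def)
  with z show ?thesis by simp
qed

text \<open>Existence by the intermediate value theorem: the value is \<open>1 < k * pi\<close> at
  0, and at least \<open>k * pi\<close> at \<open>2 * k\<close> because \<open>speed (2 * k)\<close>
  is at least \<open>2 * k\<close>. Uniqueness by strict monotonicity in the parameter.\<close>

lemma ex1_action_half_pi:
  assumes "1 / pi < k"
  shows "\<exists>!a. 0 < a \<and> a \<le> 2 * k \<and> action a (pi / 2) = k * pi"
proof -
  have k: "0 < k" "1 < k * pi"
    using assms less_trans[of 0 "1 / pi" k] by (simp_all add: pos_divide_less_eq)
  have "continuous_on {0..2*k} (\<lambda>a. action a (pi / 2))"
  proof (rule lipschitz_on_continuous_on[of "pi / 2"], rule lipschitz_onI)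
    fix a b
    show "dist (action a (pi / 2)) (action b (pi / 2)) \<le> pi / 2 * dist a b"
      using abs_primitive_diff_le[OF continuous_speed continuous_speed, of a b "\<bar>a - b\<bar>" "pi/2" 0]
        abs_speed_diff_le[of a y b y for y] action_0[of a] action_0[of b]
      by (auto simp: dist_real_def action_def mult.commute)
  qed simp
  moreover have "k * pi \<le> action (2 * k) (pi / 2)"
    using primitive_diff_ge[OF continuous_speed, of "2 * k" "2 * k" 0 "pi / 2"] action_0[of "2 * k"] k
    by (simp add: action_def speed_ge)
  ultimately obtain a where a: "0 \<le> a" "a \<le> 2 * k" "action a (pi / 2) = k * pi"
    using IVT'[of "\<lambda>a. action a (pi / 2)" 0 "k * pi" "2 * k"] k action_zero_half_pi by auto
  moreover have "a \<noteq> 0" using a k action_zero_half_pi by auto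
  moreover have "b = a" if "0 < b" "action b (pi / 2) = k * pi" for b
    using action_strict_mono[of a b "pi / 2"] action_strict_mono[of b a "pi / 2"] a that
    by (cases a b rule: linorder_cases) auto
  ultimately show ?thesis by (intro ex1I[of _ a]) auto
qed

section \<open>Estimates at the critical parameter\<close>

lemma periodic_continuous_bounded:
  fixes f :: "real \<Rightarrow> real"
  assumes "continuous_on UNIV f" and per: "\<And>y. f (y + p) = f y" and "0 < p"
  obtains M where "0 < M" "\<And>y. \<bar>f y\<bar> \<le> M"
proof -
  have "bounded (f ` {0..p})"
    using assms(1) by (intro compact_imp_bounded compact_continuous_image) (auto intro: continuous_on_subset)
  then obtain M where M: "0 < M" "\<And>y. y \<in> {0..p} \<Longrightarrow> \<bar>f y\<bar> \<le> M" by (auto simp: bounded_pos)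
  have n: "f (y + real n * p) = f y" for n y
  proof (induction n)
    case (Suc n)
    then show ?case using per[of "y + real n * p"] by (simp add: algebra_simps)
  qed simp
  have "\<bar>f y\<bar> \<le> M" for y
  proof -
    define n where "n = \<lfloor>y / p\<rfloor>"
    have "of_int n \<le> y / p" "y / p < of_int n + 1" by (simp_all add: n_def floor_correct)
    then have "y - of_int n * p \<in> {0..p}" using \<open>0 < p\<close> by (simp add: field_simps)
    moreover have "f y = f (y - of_int n * p)"
    proof (cases "0 \<le> n")
      case True
      then show ?thesis using n[of "y - of_int n * p" "nat n"] by simp
    next
      case False
      then show ?thesis using n[of y "nat (- n)"] by simp
    qed
    ultimately show ?thesis using M by simp
  qed
  with M that show ?thesis by auto
qed

text \<open>The hypothesis says that the linear term gains exactly as much per period as the action,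
  so the difference is periodic. The boundary term of the energy is then bounded whatever the end
  point.\<close>

lemma action_minus_linear_bounded:
  assumes "action a pi = 2 * k * pi"
  obtains M where "0 < M" "\<And>y. \<bar>action a y - 2 * k * y\<bar> \<le> M"
proof (rule periodic_continuous_bounded)
  show "continuous_on UNIV (\<lambda>y. action a y - 2 * k * y)"
    using DERIV_isCont[OF DERIV_action] by (intro continuous_intros) (auto intro: continuous_at_imp_continuous_on)
  show "action a (y + pi) - 2 * k * (y + pi) = action a y - 2 * k * y" for y
    using assms by (simp add: action_add_pi distrib_left)
qed (use that in auto)

text \<open>Factor the difference of squares: \<open>\<bar>speed a y - speed b y\<bar>\<close> is
  \<open>\<bar>a - b\<bar>\<close> times \<open>a + b\<close> over the sum of the speeds. That
  quotient is at least \<open>b / (b + 2)\<close>, uniformly in \<open>a\<close> and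
  \<open>y\<close>.\<close>

lemma speed_diff_ge:
  assumes "0 < a" "0 < b"
  shows "(b / (b + 2))\<^sup>2 * (a - b)\<^sup>2 \<le> (speed a y - speed b y)\<^sup>2"
proof -
  let ?s = "speed a y + speed b y"
  have s: "0 < ?s" "?s \<le> a + b + 2"
    using speed_pos[of a y] speed_pos[of b y] speed_le_add_1[of a y] speed_le_add_1[of b y] assms by auto
  have "b * ?s \<le> (a + b) * (b + 2)"
  proof -
    have "b * ?s \<le> b * (a + b + 2)" using s assms by (intro mult_left_mono) auto
    also have "\<dots> \<le> (a + b) * (b + 2)" using assms by (simp add: algebra_simps)
    finally show ?thesis .
  qed
  then have "b / (b + 2) \<le> (a + b) / ?s" using s assms by (simp add: divide_simps mult.commute)
  then have "b / (b + 2) * \<bar>a - b\<bar> \<le> (a + b) / ?s * \<bar>a - b\<bar>" by (intro mult_right_mono) auto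
  also have "\<dots> = \<bar>speed a y - speed b y\<bar>"
  proof -
    have "(speed a y - speed b y) * ?s = (a - b) * (a + b)"
      using speed_sq[of a y] speed_sq[of b y] by (simp add: algebra_simps power2_eq_square)
    then have "\<bar>speed a y - speed b y\<bar> * ?s = \<bar>a - b\<bar> * (a + b)"
      using s assms by (metis abs_mult abs_of_pos add_pos_pos)
    then show ?thesis using s by (simp add: field_simps)
  qed
  finally have "(b / (b + 2) * \<bar>a - b\<bar>)\<^sup>2 \<le> \<bar>speed a y - speed b y\<bar>\<^sup>2"
    using assms by (intro power_mono) auto
  then show ?thesis by (simp only: power_mult_distrib power2_abs)
qed

subsection \<open>Minimizers\<close>

text \<open>Young's inequality \<open>\<bar>h\<bar> \<le> e + h\<^sup>2 / e\<close> with arbitrary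
  \<open>e > 0\<close>; this replaces an almost-everywhere argument.\<close>

lemma integral_square_eq_0_imp:
  fixes h :: "real \<Rightarrow> real"
  assumes h: "h integrable_on {a..b}" and h2: "(\<lambda>x. (h x)\<^sup>2) integrable_on {a..b}"
    and 0: "integral {a..b} (\<lambda>x. (h x)\<^sup>2) \<le> 0" and x: "x \<in> {a..b}"
  shows "integral {a..x} h = 0"
proof -
  have i: "h integrable_on {a..x}" "(\<lambda>x. (h x)\<^sup>2) integrable_on {a..x}"
    using integrable_subinterval_real[OF h] integrable_subinterval_real[OF h2] x by auto
  have z: "integral {a..x} (\<lambda>x. (h x)\<^sup>2) \<le> 0"
    using integral_subset_le[OF _ i(2) h2] x 0 by fastforce
  have bound: "\<bar>integral {a..x} h\<bar> \<le> e * (x - a)" if "0 < e" for e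
  proof -
    have "norm (integral {a..x} h) \<le> integral {a..x} (\<lambda>t. e + (h t)\<^sup>2 / e)"
    proof (intro integral_norm_bound_integral i)
      show "(\<lambda>t. e + (h t)\<^sup>2 / e) integrable_on {a..x}"
        by (intro integrable_add integrable_on_divide i) auto
      fix t
      have "0 \<le> (\<bar>h t\<bar> - e)\<^sup>2" by simp
      then have "2 * e * \<bar>h t\<bar> \<le> e\<^sup>2 + (h t)\<^sup>2" by (simp add: power2_diff algebra_simps)
      moreover have "e * \<bar>h t\<bar> \<le> 2 * e * \<bar>h t\<bar>" using that by (simp add: mult_right_mono)
      moreover have "e * (e + (h t)\<^sup>2 / e) = e\<^sup>2 + (h t)\<^sup>2"
        using that by (simp add: power2_eq_square distrib_left)
      ultimately have "e * \<bar>h t\<bar> \<le> e * (e + (h t)\<^sup>2 / e)" by linarith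
      then show "norm (h t) \<le> e + (h t)\<^sup>2 / e" using that by simp
    qed
    also have "\<dots> = e * (x - a) + integral {a..x} (\<lambda>t. (h t)\<^sup>2) / e"
      using i x by (subst Henstock_Kurzweil_Integration.integral_add) (auto intro: integrable_on_divide)
    also have "\<dots> \<le> e * (x - a)" using z that by (simp add: divide_nonpos_pos)
    finally show ?thesis by simp
  qed
  have "\<bar>integral {a..x} h\<bar> \<le> 0 + e" if "0 < e" for e
  proof -
    \<comment> \<open>The extra 1 in the denominator keeps the rescaled bound meaningful at
      \<open>x = a\<close>.\<close>
    have "\<bar>integral {a..x} h\<bar> \<le> e / (x - a + 1) * (x - a)"
      using that x by (intro bound) auto
    also have "\<dots> \<le> e" using that x by (simp add: pos_divide_le_eq mult_left_mono)
    finally show ?thesis by simp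
  qed
  then have "\<bar>integral {a..x} h\<bar> \<le> 0" by (rule field_le_epsilon)
  then show ?thesis by simp
qed

text \<open>Separation of variables: \<open>travel_time a (\<phi> y) - y / \<beta>\<close> has
  derivative 0 and vanishes at 0.\<close>

lemma eq_orbitI:
  assumes "0 < a" and "\<beta> \<noteq> 0" and c: "continuous_on {0..1} \<phi>"
    and eq: "\<And>x. x \<in> {0..1} \<Longrightarrow> \<phi> x = integral {0..x} (\<lambda>t. speed a (\<phi> t) / \<beta>)"
    and x: "x \<in> {0..1}"
  shows "\<phi> x = orbit a (x / \<beta>)"
proof -
  have cs: "continuous_on {0..1} (\<lambda>t. speed a (\<phi> t) / \<beta>)"
    using c \<open>\<beta> \<noteq> 0\<close> by (intro continuous_intros) auto
  have d\<phi>: "(\<phi> has_real_derivative speed a (\<phi> y) / \<beta>) (at y within {0..1})" if y: "y \<in> {0..1}" for y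
    by (rule has_field_derivative_transform_within[OF integral_has_real_derivative[OF cs y] zero_less_one y]) (simp add: eq)
  have "\<exists>c. \<forall>y\<in>{0..1}. travel_time a (\<phi> y) - y / \<beta> = c"
  proof (rule has_field_derivative_zero_constant)
    fix y :: real assume y: "y \<in> {0..1}"
    have "((\<lambda>y. travel_time a (\<phi> y)) has_real_derivative 1 / speed a (\<phi> y) * (speed a (\<phi> y) / \<beta>)) (at y within {0..1})"
      by (rule DERIV_chain2[OF DERIV_travel_time[OF \<open>0 < a\<close>] d\<phi>[OF y]])
    then show "((\<lambda>y. travel_time a (\<phi> y) - y / \<beta>) has_real_derivative 0) (at y within {0..1})"
      using speed_pos[OF \<open>0 < a\<close>, of "\<phi> y"] \<open>\<beta> \<noteq> 0\<close> by (auto intro!: derivative_eq_intros)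
  qed simp
  then obtain c where "\<And>y. y \<in> {0..1} \<Longrightarrow> travel_time a (\<phi> y) - y / \<beta> = c" by blast
  from this[of 0] this[OF x] have "travel_time a (\<phi> x) = x / \<beta>"
    using eq[of 0] \<open>0 < a\<close> by simp
  then show ?thesis using orbit_unique[OF \<open>0 < a\<close>] by metis
qed

lemma is_minimizer_F_le: "is_minimizer \<beta> \<kappa> \<phi> g \<Longrightarrow> in_J \<psi> h \<Longrightarrow> F \<beta> \<kappa> \<phi> g \<le> F \<beta> \<kappa> \<psi> h"
  by (simp add: is_minimizer_def)

lemma minimizer_is_orbit:
  assumes "0 < \<beta>" and min: "is_minimizer \<beta> (k / \<beta>) \<phi> g" and pos: "0 < \<phi> 1"
  obtains a where "0 < a" "\<And>x. x \<in> {0..1} \<Longrightarrow> \<phi> x = orbit a (x / \<beta>)"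
proof -
  \<comment> \<open>With this parameter the orbit reaches \<open>\<phi> 1\<close> exactly at
    \<open>x = 1\<close>, so the boundary terms of \<open>\<phi>\<close> and of the competitor
    coincide.\<close>
  obtain a where a: "0 < a" "travel_time a (\<phi> 1) = 1 / \<beta>"
    using travel_time_surj[OF pos, of "1 / \<beta>"] \<open>0 < \<beta>\<close> by auto
  have J: "in_J \<phi> g" using min by (simp add: is_minimizer_def)
  let ?h = "\<lambda>x. g x - speed a (\<phi> x) / \<beta>"
  note D = H1D[of \<phi> g] and cal = F_calibration[OF J a(1) \<open>0 < \<beta>\<close>]
  have H: "H1 \<phi> g" "\<phi> 0 = 0" using J by (auto simp: in_J_def)
  have "8 * F \<beta> (k / \<beta>) \<phi> g \<le> 2 * (action a (\<phi> 1) - 2 * k * \<phi> 1) / \<beta> - a\<^sup>2 / \<beta>\<^sup>2"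
    using is_minimizer_F_le[OF min orbit_in_J[OF a(1) \<open>0 < \<beta>\<close>]] F_orbit[OF a(1) \<open>0 < \<beta>\<close>, of k] orbit_unique[OF a]
    by simp
  then have sq: "integral {0..1} (\<lambda>x. (?h x)\<^sup>2) \<le> 0" using cal(2)[of k] by linarith
  have gi: "g integrable_on {0..1}" using D(1)[OF H(1)] by (simp add: absolutely_integrable_on_def)
  have si: "(\<lambda>x. speed a (\<phi> x) / \<beta>) integrable_on {0..1}"
    using D(4)[OF H(1)] \<open>0 < \<beta>\<close> by (intro integrable_continuous_real continuous_intros) auto
  have eq: "\<phi> x = integral {0..x} (\<lambda>t. speed a (\<phi> t) / \<beta>)" if x: "x \<in> {0..1}" for x
  proof -
    have "integral {0..x} ?h = 0"
      by (rule integral_square_eq_0_imp[OF integrable_diff[OF gi si] cal(1) sq x])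
    moreover have "integral {0..x} ?h = integral {0..x} g - integral {0..x} (\<lambda>t. speed a (\<phi> t) / \<beta>)"
      using x by (intro Henstock_Kurzweil_Integration.integral_diff integrable_subinterval_real[OF gi]
          integrable_subinterval_real[OF si]) auto
    ultimately show ?thesis using D(3)[OF H(1) x] H(2) by linarith
  qed
  have "\<phi> x = orbit a (x / \<beta>)" if "x \<in> {0..1}" for x
    by (rule eq_orbitI[OF a(1) _ D(4)[OF H(1)] eq that]) (use \<open>0 < \<beta>\<close> in simp)
  then show ?thesis using that a(1) by blast
qed

text \<open>Calibration with \<open>a0\<close> bounds the energy below, and the orbit of
  \<open>a0\<close> as a competitor bounds it above. The gap of order \<open>1 / \<beta>\<close>
  controls the deviation of the actual parameter from \<open>a0\<close>.\<close>

lemma minimizer_asymptotics: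
  assumes "0 < k" "0 < a0" and act: "action a0 pi = 2 * k * pi"
  obtains M C \<beta>1 where "0 < \<beta>1"
    "\<And>\<beta> \<phi> g. 0 < \<beta> \<Longrightarrow> is_minimizer \<beta> (k / \<beta>) \<phi> g \<Longrightarrow> \<bar>F \<beta> (k / \<beta>) \<phi> g - (- a0\<^sup>2 / (8 * \<beta>\<^sup>2))\<bar> \<le> M / \<beta>"
    "\<And>\<beta> \<phi> g. 0 < \<beta> \<Longrightarrow> \<beta> < \<beta>1 \<Longrightarrow> is_minimizer \<beta> (k / \<beta>) \<phi> g \<Longrightarrow>
        \<exists>a>0. (a - a0)\<^sup>2 \<le> C * \<beta> \<and> (\<forall>x\<in>{0..1}. \<phi> x = orbit a (x / \<beta>))"
proof -
  obtain M where M: "0 < M" "\<And>y. \<bar>action a0 y - 2 * k * y\<bar> \<le> M"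
    using action_minus_linear_bounded[OF act] by blast
  have M': "\<bar>2 * (action a0 y - 2 * k * y) / \<beta>\<bar> \<le> 2 * M / \<beta>" if "0 < \<beta>" for y \<beta>
    using M(2)[of y] that by (simp add: abs_mult divide_right_mono)
  have up: "8 * F \<beta> (k / \<beta>) \<phi> g \<le> 2 * M / \<beta> - a0\<^sup>2 / \<beta>\<^sup>2" if "0 < \<beta>" "is_minimizer \<beta> (k / \<beta>) \<phi> g" for \<beta> \<phi> g
    using is_minimizer_F_le[OF that(2) orbit_in_J[OF \<open>0 < a0\<close> that(1)]] F_orbit[OF \<open>0 < a0\<close> that(1), of k]
      M'[OF that(1), of "orbit a0 (1 / \<beta>)"]
    by linarith
  have low: "integral {0..1} (\<lambda>x. (g x - speed a0 (\<phi> x) / \<beta>)\<^sup>2) - 2 * M / \<beta> - a0\<^sup>2 / \<beta>\<^sup>2 \<le> 8 * F \<beta> (k / \<beta>) \<phi> g"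
    if "0 < \<beta>" "in_J \<phi> g" for \<beta> \<phi> g
    using F_calibration(2)[OF that(2) \<open>0 < a0\<close> that(1), of k] abs_le_D2[OF M'[OF that(1), of "\<phi> 1"]] by linarith
  show ?thesis
  \<comment> \<open>The first constant makes the upper energy bound negative; \<open>M / 4\<close>
    is \<open>2 * M\<close> divided by 8; in the third, \<open>4 * M\<close> adds the two boundary
    errors and the denominator comes from \<open>speed_diff_ge\<close>.\<close>
  proof (rule that[of "a0\<^sup>2 / (2 * M)" "M / 4" "4 * M / (a0 / (a0 + 2))\<^sup>2"])
    show "0 < a0\<^sup>2 / (2 * M)" using M \<open>0 < a0\<close> by simp
  next
    fix \<beta> \<phi> g assume \<beta>: "0 < \<beta>" and min: "is_minimizer \<beta> (k / \<beta>) \<phi> g"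
    then have J: "in_J \<phi> g" by (simp add: is_minimizer_def)
    have "0 \<le> integral {0..1} (\<lambda>x. (g x - speed a0 (\<phi> x) / \<beta>)\<^sup>2)"
      by (intro integral_nonneg F_calibration J \<open>0 < a0\<close> \<beta>) simp
    then have "\<bar>8 * F \<beta> (k / \<beta>) \<phi> g + a0\<^sup>2 / \<beta>\<^sup>2\<bar> \<le> 2 * M / \<beta>"
      using low[OF \<beta> J] up[OF \<beta> min] by linarith
    moreover have "F \<beta> (k / \<beta>) \<phi> g - (- a0\<^sup>2 / (8 * \<beta>\<^sup>2)) = (8 * F \<beta> (k / \<beta>) \<phi> g + a0\<^sup>2 / \<beta>\<^sup>2) / 8"
      by simp
    ultimately show "\<bar>F \<beta> (k / \<beta>) \<phi> g - (- a0\<^sup>2 / (8 * \<beta>\<^sup>2))\<bar> \<le> M / 4 / \<beta>"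
      by simp
  next
    fix \<beta> \<phi> g assume \<beta>: "0 < \<beta>" "\<beta> < a0\<^sup>2 / (2 * M)" and min: "is_minimizer \<beta> (k / \<beta>) \<phi> g"
    then have J: "in_J \<phi> g" by (simp add: is_minimizer_def)
    have "2 * M / \<beta> < a0\<^sup>2 / \<beta>\<^sup>2" using \<beta> M by (simp add: field_simps power2_eq_square)
    then have neg: "F \<beta> (k / \<beta>) \<phi> g < 0" using up[OF \<beta>(1) min] by linarith
    have "0 < \<phi> 1"
    proof (rule ccontr)
      assume "\<not> 0 < \<phi> 1"
      then have "k / \<beta> / 2 * \<phi> 1 \<le> 0"
        using \<open>0 < k\<close> \<beta> by (intro mult_nonneg_nonpos) auto
      \<comment> \<open>In the non-integrable case the integral is 0 by default. A nonpositive end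
        value would thus make the energy nonnegative.\<close>
      moreover have "0 \<le> integral {0..1} (\<lambda>x. (g x)\<^sup>2 + 1 / \<beta>\<^sup>2 * (sin (\<phi> x))\<^sup>2)"
        by (cases "(\<lambda>x. (g x)\<^sup>2 + 1 / \<beta>\<^sup>2 * (sin (\<phi> x))\<^sup>2) integrable_on {0..1}")
          (auto intro: integral_nonneg simp: not_integrable_integral)
      ultimately show False using neg F_eq_integral[OF J, of \<beta> "k / \<beta>"] by linarith
    qed
    then obtain a where a: "0 < a" "\<And>x. x \<in> {0..1} \<Longrightarrow> \<phi> x = orbit a (x / \<beta>)"
      using minimizer_is_orbit[OF \<beta>(1) min] by blast
    \<comment> \<open>From here the explicit derivative \<open>?h\<close> replaces the weak
      derivative \<open>g\<close>, so that the square can be bounded pointwise. The energy does not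
      increase, since calibration with \<open>a\<close> leaves only a nonnegative square for
      \<open>\<phi>\<close>.\<close>
    let ?\<psi> = "\<lambda>x. orbit a (x / \<beta>)" and ?h = "\<lambda>x. speed a (orbit a (x / \<beta>)) / \<beta>"
    note J\<psi> = orbit_in_J[OF a(1) \<beta>(1)]
    have "0 \<le> integral {0..1} (\<lambda>x. (g x - speed a (\<phi> x) / \<beta>)\<^sup>2)"
      by (intro integral_nonneg F_calibration J a \<beta>) simp
    then have "8 * F \<beta> (k / \<beta>) ?\<psi> ?h \<le> 8 * F \<beta> (k / \<beta>) \<phi> g"
      using F_calibration(2)[OF J a(1) \<beta>(1), of k] F_orbit[OF a(1) \<beta>(1), of k] a(2)[of 1] by simp
    then have ub: "integral {0..1} (\<lambda>x. (?h x - speed a0 (?\<psi> x) / \<beta>)\<^sup>2) \<le> 4 * M / \<beta>"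
      using low[OF \<beta>(1) J\<psi>] up[OF \<beta>(1) min] by linarith
    have "integral {0..1} (\<lambda>x::real. (a0 / (a0 + 2))\<^sup>2 * (a - a0)\<^sup>2 / \<beta>\<^sup>2)
        \<le> integral {0..1} (\<lambda>x. (?h x - speed a0 (?\<psi> x) / \<beta>)\<^sup>2)"
    proof (rule integral_le)
      show "(\<lambda>x. (?h x - speed a0 (?\<psi> x) / \<beta>)\<^sup>2) integrable_on {0..1}"
        by (rule F_calibration(1)[OF J\<psi> \<open>0 < a0\<close> \<beta>(1)])
      show "(a0 / (a0 + 2))\<^sup>2 * (a - a0)\<^sup>2 / \<beta>\<^sup>2 \<le> (?h x - speed a0 (?\<psi> x) / \<beta>)\<^sup>2" for x
        using divide_right_mono[OF speed_diff_ge[OF a(1) \<open>0 < a0\<close>], of "\<beta>\<^sup>2"]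
        by (simp add: power_divide flip: diff_divide_distrib)
    qed auto
    with ub have "(a0 / (a0 + 2))\<^sup>2 * (a - a0)\<^sup>2 / \<beta>\<^sup>2 \<le> 4 * M / \<beta>" by simp
    then have "(a0 / (a0 + 2))\<^sup>2 * (a - a0)\<^sup>2 \<le> 4 * M / \<beta> * \<beta>\<^sup>2" using \<beta> by (simp add: pos_divide_le_eq)
    also have "\<dots> = 4 * M * \<beta>" using \<beta> by (simp add: power2_eq_square)
    finally have "(a - a0)\<^sup>2 \<le> 4 * M / (a0 / (a0 + 2))\<^sup>2 * \<beta>"
      using \<open>0 < a0\<close> by (simp add: pos_le_divide_eq mult.commute)
    with a show "\<exists>a>0. (a - a0)\<^sup>2 \<le> 4 * M / (a0 / (a0 + 2))\<^sup>2 * \<beta> \<and> (\<forall>x\<in>{0..1}. \<phi> x = orbit a (x / \<beta>))"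
      by blast
  qed
qed

subsection \<open>Higher derivatives of orbits\<close>

text \<open>Expressions in \<open>P\<close> and \<open>P'\<close>, closed under differentiation along \<open>P'' = sin P cos P\<close>.\<close>
datatype jet = Pos | Vel | SinPos | CosPos | Neg jet | Add jet jet | Mul jet jet

primrec jet_eval :: "real \<Rightarrow> real \<Rightarrow> jet \<Rightarrow> real" where
  "jet_eval u v Pos = u"
| "jet_eval u v Vel = v"
| "jet_eval u v SinPos = sin u"
| "jet_eval u v CosPos = cos u"
| "jet_eval u v (Neg s) = - jet_eval u v s"
| "jet_eval u v (Add s t) = jet_eval u v s + jet_eval u v t"
| "jet_eval u v (Mul s t) = jet_eval u v s * jet_eval u v t"

primrec jet_deriv :: "jet \<Rightarrow> jet" where
  "jet_deriv Pos = Vel"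
| "jet_deriv Vel = Mul SinPos CosPos"
| "jet_deriv SinPos = Mul CosPos Vel"
| "jet_deriv CosPos = Neg (Mul SinPos Vel)"
| "jet_deriv (Neg s) = Neg (jet_deriv s)"
| "jet_deriv (Add s t) = Add (jet_deriv s) (jet_deriv t)"
| "jet_deriv (Mul s t) = Add (Mul (jet_deriv s) t) (Mul s (jet_deriv t))"

definition orbit_jet :: "real \<Rightarrow> jet \<Rightarrow> real \<Rightarrow> real" where
  "orbit_jet a t x = jet_eval (orbit a x) (speed a (orbit a x)) t"

lemma DERIV_orbit_jet:
  assumes "0 < a"
  shows "DERIV (orbit_jet a t) x :> orbit_jet a (jet_deriv t) x"
proof (induction t)
  case (Mul s t)
  then show ?case unfolding orbit_jet_def
    by (auto intro!: derivative_eq_intros simp: orbit_jet_def)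
next
  case (Add s t)
  then show ?case unfolding orbit_jet_def by (auto intro!: derivative_eq_intros)
next
  case (Neg s)
  then show ?case unfolding orbit_jet_def by (auto intro!: derivative_eq_intros)
qed (auto simp: orbit_jet_def intro!: derivative_eq_intros DERIV_orbit DERIV_speed_orbit assms)

definition orbit_derivs :: "real \<Rightarrow> nat \<Rightarrow> real \<Rightarrow> real" where
  "orbit_derivs a k = orbit_jet a ((jet_deriv ^^ k) Pos)"

lemma orbit_derivs_simps [simp]:
  "orbit_derivs a 0 x = orbit a x"
  "orbit_derivs a 1 x = speed a (orbit a x)"
  "orbit_derivs a 2 x = sin (orbit a x) * cos (orbit a x)"
  by (simp_all add: orbit_derivs_def orbit_jet_def numeral_2_eq_2)

lemma DERIV_orbit_derivs: "0 < a \<Longrightarrow> DERIV (orbit_derivs a k) x :> orbit_derivs a (Suc k) x"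
  using DERIV_orbit_jet[of a] by (simp add: orbit_derivs_def)

lemma smooth_derivs_orbit: "0 < a \<Longrightarrow> smooth_derivs S (orbit a) (orbit_derivs a)"
  by (auto simp: smooth_derivs_def intro: DERIV_orbit_derivs has_field_derivative_at_within)

text \<open>Each derivative brings a factor \<open>1 / \<beta>\<close>; the factor
  \<open>\<beta> ^ k\<close> in the convergence statement compensates for these.\<close>

lemma smooth_derivs_orbit_scaled:
  assumes "0 < a" and "\<And>x. x \<in> S \<Longrightarrow> f x = orbit a (x / \<beta>)"
  shows "smooth_derivs S f (\<lambda>k x. orbit_derivs a k (x / \<beta>) / \<beta> ^ k)"
  unfolding smooth_derivs_def
proof (intro conjI allI ballI)
  fix k x
  have "DERIV (\<lambda>x. orbit_derivs a k (x / \<beta>)) x :> orbit_derivs a (Suc k) (x / \<beta>) * (1 / \<beta>)"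
    by (rule DERIV_chain2[OF DERIV_orbit_derivs[OF assms(1)] DERIV_cdivide[OF DERIV_ident]])
  from DERIV_cdivide[OF this, of "\<beta> ^ k"]
  show "((\<lambda>x. orbit_derivs a k (x / \<beta>) / \<beta> ^ k) has_real_derivative orbit_derivs a (Suc k) (x / \<beta>) / \<beta> ^ Suc k) (at x within S)"
    by (simp add: has_field_derivative_at_within)
qed (simp add: assms)

text \<open>Induction over expressions. The atoms are controlled by the distances of the parameters
  and of the orbits; products also use that the limits are bounded on the compact set. The filter
  \<open>nhds a0\<close> admits \<open>a = a0\<close>, which a minimizer may have.\<close>

lemma uniform_limit_orbit_jet:
  assumes "0 < a0" and K: "compact K"
  shows "uniform_limit K (\<lambda>a. orbit_jet a t) (orbit_jet a0 t) (nhds a0)"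
proof -
  have cont: "continuous_on K (orbit_jet a0 t)" for t
    using DERIV_isCont[OF DERIV_orbit_jet[OF \<open>0 < a0\<close>]] by (auto intro: continuous_at_imp_continuous_on)
  then have bdd: "bounded (orbit_jet a0 t ` K)" for t
    using K by (intro compact_imp_bounded compact_continuous_image)
  obtain R where R: "0 < R" "\<And>x. x \<in> K \<Longrightarrow> \<bar>x\<bar> \<le> R"
    using compact_imp_bounded[OF K] by (auto simp: bounded_pos)
  have ev: "\<forall>\<^sub>F a in nhds a0. 0 < a"
    using eventually_nhds_in_open[of "{0<..}" a0] \<open>0 < a0\<close> by auto
  have orb: "uniform_limit K orbit (orbit a0) (nhds a0)"
  proof (rule uniform_limitI)
    fix e :: real assume "0 < e"
    let ?B = "\<lambda>a. (a + 1) * (\<bar>a - a0\<bar> / (a * a0)) * ((a0 + 1) * R)"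
    have "(?B \<longlongrightarrow> 0) (nhds a0)" using \<open>0 < a0\<close>
      by (auto intro!: tendsto_eq_intros filterlim_ident)
    then have "\<forall>\<^sub>F a in nhds a0. ?B a < e" using \<open>0 < e\<close> by (rule order_tendstoD)
    with ev show "\<forall>\<^sub>F a in nhds a0. \<forall>x\<in>K. dist (orbit a x) (orbit a0 x) < e"
    proof eventually_elim
      case (elim a)
      have "\<bar>orbit a x - orbit a0 x\<bar> \<le> ?B a" if "x \<in> K" for x
        by (rule order_trans[OF orbit_dependence[OF elim(1) \<open>0 < a0\<close>]])
          (use elim(1) \<open>0 < a0\<close> R(2)[OF that] in \<open>intro mult_left_mono, auto\<close>)
      then show ?case using elim(2) by (fastforce simp: dist_real_def)
    qed
  qed
  have lip: "uniform_limit K f l (nhds a0)"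
    if "\<And>a x. \<bar>f a x - l x\<bar> \<le> \<bar>a - a0\<bar> + \<bar>orbit a x - orbit a0 x\<bar>" for f l
  proof (rule uniform_limitI)
    fix e :: real assume "0 < e"
    then have "\<forall>\<^sub>F a in nhds a0. \<bar>a - a0\<bar> < e / 2" "\<forall>\<^sub>F a in nhds a0. \<forall>x\<in>K. dist (orbit a x) (orbit a0 x) < e / 2"
      using uniform_limitD[OF orb, of "e / 2"]
      by (auto simp: eventually_nhds_metric dist_real_def intro!: exI[of _ "e / 2"])
    then show "\<forall>\<^sub>F a in nhds a0. \<forall>x\<in>K. dist (f a x) (l x) < e"
    proof eventually_elim
      case (elim a)
      show ?case
      proof
        fix x assume "x \<in> K"
        then have "\<bar>orbit a x - orbit a0 x\<bar> < e / 2" using elim by (simp add: dist_real_def)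
        then show "dist (f a x) (l x) < e" using elim(1) that[of a x] by (simp add: dist_real_def)
      qed
    qed
  qed
  show ?thesis
  proof (induction t)
    case Pos
    then show ?case using orb by (simp add: orbit_jet_def)
  next
    case Vel
    show ?case unfolding orbit_jet_def
      by (rule lip) (use abs_speed_diff_le in simp)
  next
    case SinPos
    show ?case unfolding orbit_jet_def
      by (rule lip) (auto intro: order_trans[OF abs_sin_diff_le])
  next
    case CosPos
    show ?case unfolding orbit_jet_def
      by (rule lip) (auto intro: order_trans[OF abs_cos_diff_le])
  next
    case (Neg s)
    then show ?case unfolding orbit_jet_def by (auto intro!: uniform_limit_intros)
  next
    case (Add s t)
    then show ?case unfolding orbit_jet_def by (auto intro!: uniform_limit_intros)
  next
    case (Mul s t)
    from uniform_lim_mult[OF this bdd bdd]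
    show ?case by (simp add: orbit_jet_def)
  qed
qed

subsection \<open>Asymptotics of the minimizers\<close>

theorem theorem2:
  fixes \<kappa>t :: real
    and \<phi> :: "real \<Rightarrow> real \<Rightarrow> real"
    and g :: "real \<Rightarrow> real \<Rightarrow> real"
  assumes hk: "\<kappa>t > 1 / pi"
    and hmin: "\<forall>\<beta>>0. is_minimizer \<beta> (\<kappa>t / \<beta>) (\<phi> \<beta>) (g \<beta>)"
  shows
    "(\<exists>\<beta>0>0. \<forall>\<beta>. 0 < \<beta> \<and> \<beta> < \<beta>0 \<longrightarrow>
        (\<exists>!T. T \<in> {0<..<1} \<and> \<phi> \<beta> T = pi) \<and>
        (\<forall>T\<in>{0<..<1}. \<phi> \<beta> T = pi \<longrightarrow> (\<forall>x\<in>{0..1-T}. \<phi> \<beta> (x + T) = pi + \<phi> \<beta> x)))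
     \<and> (\<exists>c C. 0 < c \<and> c < C \<and> (\<exists>\<beta>0>0. \<forall>\<beta>. 0 < \<beta> \<and> \<beta> < \<beta>0 \<longrightarrow>
        (\<forall>T\<in>{0<..<1}. \<phi> \<beta> T = pi \<longrightarrow>
            c / \<beta> \<le> real_of_int \<lfloor>1 / T\<rfloor> \<and> real_of_int \<lfloor>1 / T\<rfloor> \<le> C / \<beta>)))
     \<and> (\<exists>!\<alpha>0. 0 < \<alpha>0 \<and> \<alpha>0 \<le> 2 * \<kappa>t \<and>
          integral {0..pi/2} (\<lambda>y. sqrt (\<alpha>0\<^sup>2 + (sin y)\<^sup>2)) = \<kappa>t * pi)
     \<and> (\<forall>\<alpha>0. 0 < \<alpha>0 \<and> \<alpha>0 \<le> 2 * \<kappa>t \<and>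
          integral {0..pi/2} (\<lambda>y. sqrt (\<alpha>0\<^sup>2 + (sin y)\<^sup>2)) = \<kappa>t * pi \<longrightarrow>
        (\<exists>M \<beta>0. \<beta>0 > 0 \<and> (\<forall>\<beta>. 0 < \<beta> \<and> \<beta> < \<beta>0 \<longrightarrow>
            \<bar>F \<beta> (\<kappa>t / \<beta>) (\<phi> \<beta>) (g \<beta>) - (- \<alpha>0\<^sup>2 / (8 * \<beta>\<^sup>2))\<bar> \<le> M / \<beta>))
        \<and> (\<exists>\<phi>0 D0. smooth_derivs {0..} \<phi>0 D0 \<and>
             (\<forall>x\<ge>0. D0 2 x = sin (\<phi>0 x) * cos (\<phi>0 x)) \<and>
             \<phi>0 0 = 0 \<and> D0 1 0 = \<alpha>0 \<and>
             (\<forall>K. compact K \<and> K \<subseteq> {0..} \<longrightarrow> (\<forall>k::nat. \<forall>\<epsilon>>0. \<exists>\<beta>0>0. \<forall>\<beta>. 0 < \<beta> \<and> \<beta> < \<beta>0 \<longrightarrow>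
                (\<exists>D. smooth_derivs {0..1} (\<phi> \<beta>) D \<and>
                     (\<forall>x\<in>K. \<bar>\<beta> ^ k * D k (\<beta> * x) - D0 k x\<bar> \<le> \<epsilon>))))))"
    (is "?period \<and> ?count \<and> ?unique \<and> ?limit")
proof -
  have k: "0 < \<kappa>t" using hk by (rule less_trans[rotated]) simp
  have ex1: "\<exists>!a. 0 < a \<and> a \<le> 2 * \<kappa>t \<and> action a (pi / 2) = \<kappa>t * pi"
    by (rule ex1_action_half_pi[OF hk])
  then obtain a0 where a0: "0 < a0" "a0 \<le> 2 * \<kappa>t" "action a0 (pi / 2) = \<kappa>t * pi" by blast
  have act: "action a0 pi = 2 * \<kappa>t * pi" using a0(3) action_pi[of a0] by simp
  obtain M C \<beta>1 where \<beta>1: "0 < \<beta>1"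
    and en: "\<And>\<beta> \<phi> g. 0 < \<beta> \<Longrightarrow> is_minimizer \<beta> (\<kappa>t / \<beta>) \<phi> g \<Longrightarrow> \<bar>F \<beta> (\<kappa>t / \<beta>) \<phi> g - (- a0\<^sup>2 / (8 * \<beta>\<^sup>2))\<bar> \<le> M / \<beta>"
    and orb: "\<And>\<beta> \<phi> g. 0 < \<beta> \<Longrightarrow> \<beta> < \<beta>1 \<Longrightarrow> is_minimizer \<beta> (\<kappa>t / \<beta>) \<phi> g \<Longrightarrow>
        \<exists>a>0. (a - a0)\<^sup>2 \<le> C * \<beta> \<and> (\<forall>x\<in>{0..1}. \<phi> x = orbit a (x / \<beta>))"
    by (rule minimizer_asymptotics[OF k a0(1) act]) (rule that)
  have close: "\<exists>\<beta>0>0. \<forall>\<beta>. 0 < \<beta> \<and> \<beta> < \<beta>0 \<longrightarrow>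
      (\<exists>a>0. \<bar>a - a0\<bar> < d \<and> (\<forall>x\<in>{0..1}. \<phi> \<beta> x = orbit a (x / \<beta>)))" if "0 < d" for d
  \<comment> \<open>This threshold forces \<open>C * \<beta> < d\<^sup>2\<close>; using
    \<open>\<bar>C\<bar> + 1\<close> keeps the denominator positive.\<close>
  proof (rule exI[of _ "min \<beta>1 (d\<^sup>2 / (\<bar>C\<bar> + 1))"], intro conjI allI impI)
    show "0 < min \<beta>1 (d\<^sup>2 / (\<bar>C\<bar> + 1))" using \<beta>1 that by (simp add: add_nonneg_pos)
    fix \<beta> assume \<beta>: "0 < \<beta> \<and> \<beta> < min \<beta>1 (d\<^sup>2 / (\<bar>C\<bar> + 1))"
    then obtain a where a: "0 < a" "(a - a0)\<^sup>2 \<le> C * \<beta>" "\<forall>x\<in>{0..1}. \<phi> \<beta> x = orbit a (x / \<beta>)"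
      using orb[of \<beta> "\<phi> \<beta>" "g \<beta>"] hmin by auto
    have "C * \<beta> \<le> (\<bar>C\<bar> + 1) * \<beta>" using \<beta> by (intro mult_right_mono) auto
    also have "\<dots> < d\<^sup>2" using \<beta> by (simp add: pos_less_divide_eq add_nonneg_pos mult.commute)
    finally have "\<bar>a - a0\<bar>\<^sup>2 < d\<^sup>2" using a by simp
    then have "\<bar>a - a0\<bar> < d" by (rule power_less_imp_less_base) (use that in simp)
    with a show "\<exists>a>0. \<bar>a - a0\<bar> < d \<and> (\<forall>x\<in>{0..1}. \<phi> \<beta> x = orbit a (x / \<beta>))" by blast
  qed
  obtain \<beta>2 where \<beta>2: "0 < \<beta>2" and near: "\<And>\<beta>. 0 < \<beta> \<Longrightarrow> \<beta> < \<beta>2 \<Longrightarrow>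
      \<exists>a>0. \<bar>a - a0\<bar> < a0 / 2 \<and> (\<forall>x\<in>{0..1}. \<phi> \<beta> x = orbit a (x / \<beta>))"
    using close[of "a0 / 2"] a0(1) by auto
  \<comment> \<open>As \<open>travel_time a pi\<close> is at most \<open>2 * pi / a0\<close>, this
    puts the candidate \<open>T\<close> below 1/2, which also leaves room for the rounding in the
    count.\<close>
  define \<beta>3 where "\<beta>3 = min \<beta>2 (a0 / (4 * pi))"
  have \<beta>3: "0 < \<beta>3" using \<beta>2 a0 by (simp add: \<beta>3_def)
  have T: "\<exists>a>0. (\<forall>x\<in>{0..1}. \<phi> \<beta> x = orbit a (x / \<beta>)) \<and> 0 < \<beta> * travel_time a pi \<and> \<beta> * travel_time a pi < 1 \<and>
      (\<forall>T\<in>{0<..<1}. \<phi> \<beta> T = pi \<longleftrightarrow> T = \<beta> * travel_time a pi) \<and>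
      pi / (2 * a0 + 1) \<le> travel_time a pi \<and> travel_time a pi \<le> 2 * pi / a0"
    if \<beta>: "0 < \<beta>" "\<beta> < \<beta>3" for \<beta>
  proof -
    obtain a where a: "0 < a" "\<bar>a - a0\<bar> < a0 / 2" "\<forall>x\<in>{0..1}. \<phi> \<beta> x = orbit a (x / \<beta>)"
      using near[of \<beta>] \<beta> by (auto simp: \<beta>3_def)
    have a': "a \<le> 2 * a0" "a0 / 2 \<le> a" using a(2) a0(1) by linarith+
    have "pi / (2 * a0 + 1) \<le> pi / (a + 1)" using a a' a0 by (intro divide_left_mono) auto
    also have "\<dots> \<le> travel_time a pi" using travel_time_diff_ge[OF a(1), of 0 pi] a by simp
    finally have lo: "pi / (2 * a0 + 1) \<le> travel_time a pi" .
    have "travel_time a pi \<le> pi / a" using abs_travel_time_le[OF a(1), of pi] by simp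
    also have "\<dots> \<le> pi / (a0 / 2)" using a a' a0 by (intro divide_left_mono) auto
    finally have hi: "travel_time a pi \<le> 2 * pi / a0" by (simp add: mult.commute)
    have "0 < pi / (2 * a0 + 1)" using a0 by simp
    then have pos: "0 < travel_time a pi" using lo by linarith
    have "\<beta> * travel_time a pi \<le> \<beta> * (2 * pi / a0)" using hi \<beta> by (intro mult_left_mono) auto
    also have "\<dots> < 1" using \<beta> a0 by (simp add: \<beta>3_def field_simps)
    finally have lt: "\<beta> * travel_time a pi < 1" .
    have "\<phi> \<beta> T = pi \<longleftrightarrow> T = \<beta> * travel_time a pi" if "T \<in> {0<..<1}" for T
    proof -
      have "\<phi> \<beta> T = orbit a (T / \<beta>)" using a(3) that by simp
      then have "\<phi> \<beta> T = pi \<longleftrightarrow> T / \<beta> = travel_time a pi"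
        using orbit_unique[OF a(1)] travel_time_orbit[OF a(1)] by metis
      then show ?thesis using \<beta> by (simp add: field_simps)
    qed
    with a pos lt lo hi \<beta> show ?thesis by (intro exI[of _ a]) simp
  qed
  have ?period
  proof (intro exI[of _ \<beta>3] conjI allI impI ballI \<beta>3)
    fix \<beta> assume "0 < \<beta> \<and> \<beta> < \<beta>3"
    then obtain a where a: "0 < a" "\<And>x. x \<in> {0..1} \<Longrightarrow> \<phi> \<beta> x = orbit a (x / \<beta>)"
      "0 < \<beta> * travel_time a pi" "\<beta> * travel_time a pi < 1"
      "\<And>T. T \<in> {0<..<1} \<Longrightarrow> \<phi> \<beta> T = pi \<longleftrightarrow> T = \<beta> * travel_time a pi" and \<beta>: "0 < \<beta>"
      using T[of \<beta>] by blast
    show "\<exists>!T. T \<in> {0<..<1} \<and> \<phi> \<beta> T = pi"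
      using a(3,4,5) by (intro ex1I[of _ "\<beta> * travel_time a pi"]) auto
    fix T x assume "T \<in> {0<..<1}" "\<phi> \<beta> T = pi" and x: "x \<in> {0..1-T}"
    then have "T = \<beta> * travel_time a pi" using a(5) by blast
    then have "(x + T) / \<beta> = x / \<beta> + travel_time a pi" using \<beta> by (simp add: add_divide_distrib)
    then show "\<phi> \<beta> (x + T) = pi + \<phi> \<beta> x"
      using a(2)[of "x + T"] a(2)[of x] x \<open>T \<in> {0<..<1}\<close> orbit_add_period[OF a(1), of "x / \<beta>"] by simp
  qed
  moreover have ?count
  proof (rule exI[of _ "a0 / (4 * pi)"], rule exI[of _ "(2 * a0 + 1) / pi"], intro exI[of _ \<beta>3] conjI allI impI ballI \<beta>3)
    show "0 < a0 / (4 * pi)" using a0 by simp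
    show "a0 / (4 * pi) < (2 * a0 + 1) / pi" using a0 by (simp add: divide_simps)
    fix \<beta> T assume asm: "0 < \<beta> \<and> \<beta> < \<beta>3" "T \<in> {0<..<1}" "\<phi> \<beta> T = pi"
    then obtain a where a: "T = \<beta> * travel_time a pi"
      "pi / (2 * a0 + 1) \<le> travel_time a pi" "travel_time a pi \<le> 2 * pi / a0" and \<beta>: "0 < \<beta>"
      using T[of \<beta>] by blast
    have T0: "0 < T" using asm by simp
    have "\<beta> * (pi / (2 * a0 + 1)) \<le> T" unfolding a(1) using a \<beta> by (intro mult_left_mono) auto
    then have "1 / T \<le> 1 / (\<beta> * (pi / (2 * a0 + 1)))" using \<beta> a0 by (intro divide_left_mono mult_pos_pos T0) auto
    also have "\<dots> = (2 * a0 + 1) / pi / \<beta>" by simp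
    finally show "real_of_int \<lfloor>1 / T\<rfloor> \<le> (2 * a0 + 1) / pi / \<beta>" by linarith
    have "T \<le> \<beta> * (2 * pi / a0)" unfolding a(1) using a \<beta> by (intro mult_left_mono) auto
    then have "1 / (\<beta> * (2 * pi / a0)) \<le> 1 / T" using \<beta> a0 by (intro divide_left_mono mult_pos_pos T0) auto
    \<comment> \<open>Rounding down costs less than 1. The lower bound for \<open>1 / T\<close> is
      twice the claimed one, and the claimed one is at least 1, so half of it absorbs the
      loss.\<close>
    moreover have "1 / (\<beta> * (2 * pi / a0)) = 2 * (a0 / (4 * pi) / \<beta>)" by simp
    moreover have "1 \<le> a0 / (4 * pi) / \<beta>"
      using asm \<beta> by (simp add: \<beta>3_def pos_less_divide_eq mult_ac)
    ultimately show "a0 / (4 * pi) / \<beta> \<le> real_of_int \<lfloor>1 / T\<rfloor>" by linarith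
  qed
  moreover have ?unique using ex1 by (simp add: action_half_pi)
  moreover have ?limit
  proof (intro allI impI)
    fix \<alpha>0 assume "0 < \<alpha>0 \<and> \<alpha>0 \<le> 2 * \<kappa>t \<and> integral {0..pi/2} (\<lambda>y. sqrt (\<alpha>0\<^sup>2 + (sin y)\<^sup>2)) = \<kappa>t * pi"
    then have \<alpha>0: "\<alpha>0 = a0" using ex1 a0 by (auto simp: action_half_pi)
    have energy: "\<exists>M \<beta>0. \<beta>0 > 0 \<and> (\<forall>\<beta>. 0 < \<beta> \<and> \<beta> < \<beta>0 \<longrightarrow>
            \<bar>F \<beta> (\<kappa>t / \<beta>) (\<phi> \<beta>) (g \<beta>) - (- \<alpha>0\<^sup>2 / (8 * \<beta>\<^sup>2))\<bar> \<le> M / \<beta>)"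
      using en hmin \<alpha>0 zero_less_one by blast
    have conv: "\<exists>\<beta>0>0. \<forall>\<beta>. 0 < \<beta> \<and> \<beta> < \<beta>0 \<longrightarrow> (\<exists>D. smooth_derivs {0..1} (\<phi> \<beta>) D \<and>
        (\<forall>x\<in>K. \<bar>\<beta> ^ k * D k (\<beta> * x) - orbit_derivs a0 k x\<bar> \<le> \<epsilon>))"
      if "compact K" "0 < \<epsilon>" for K k \<epsilon>
    proof -
      have "\<forall>\<^sub>F a in nhds a0. \<forall>x\<in>K. dist (orbit_derivs a k x) (orbit_derivs a0 k x) < \<epsilon>"
        using uniform_limitD[OF uniform_limit_orbit_jet[OF a0(1) that(1)] that(2)] by (simp add: orbit_derivs_def)
      then obtain d where d: "0 < d" "\<And>a x. \<bar>a - a0\<bar> < d \<Longrightarrow> x \<in> K \<Longrightarrow> \<bar>orbit_derivs a k x - orbit_derivs a0 k x\<bar> < \<epsilon>"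
        by (auto simp: eventually_nhds_metric dist_real_def)
      from close[OF d(1)] obtain \<beta>4 where "0 < \<beta>4" and \<beta>4: "\<And>\<beta>. 0 < \<beta> \<Longrightarrow> \<beta> < \<beta>4 \<Longrightarrow>
        \<exists>a>0. \<bar>a - a0\<bar> < d \<and> (\<forall>x\<in>{0..1}. \<phi> \<beta> x = orbit a (x / \<beta>))" by blast
      show ?thesis
      proof (intro exI[of _ \<beta>4] conjI allI impI \<open>0 < \<beta>4\<close>)
        fix \<beta> assume \<beta>: "0 < \<beta> \<and> \<beta> < \<beta>4"
        then obtain a where a: "0 < a" "\<bar>a - a0\<bar> < d" "\<And>x. x \<in> {0..1} \<Longrightarrow> \<phi> \<beta> x = orbit a (x / \<beta>)"
          using \<beta>4 by blast
        \<comment> \<open>The witness for \<open>D\<close> is given by the orbit on the whole line,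
          so the estimate covers every \<open>x\<close> in \<open>K\<close>, wherever
          \<open>\<beta> * x\<close> lies.\<close>
        have "\<bar>\<beta> ^ k * (orbit_derivs a k (\<beta> * x / \<beta>) / \<beta> ^ k) - orbit_derivs a0 k x\<bar> \<le> \<epsilon>" if "x \<in> K" for x
          using d(2)[OF a(2) that] \<beta> by simp
        with smooth_derivs_orbit_scaled[OF a(1,3)]
        show "\<exists>D. smooth_derivs {0..1} (\<phi> \<beta>) D \<and> (\<forall>x\<in>K. \<bar>\<beta> ^ k * D k (\<beta> * x) - orbit_derivs a0 k x\<bar> \<le> \<epsilon>)"
          by blast
      qed
    qed
    show "(\<exists>M \<beta>0. \<beta>0 > 0 \<and> (\<forall>\<beta>. 0 < \<beta> \<and> \<beta> < \<beta>0 \<longrightarrow>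
            \<bar>F \<beta> (\<kappa>t / \<beta>) (\<phi> \<beta>) (g \<beta>) - (- \<alpha>0\<^sup>2 / (8 * \<beta>\<^sup>2))\<bar> \<le> M / \<beta>))
        \<and> (\<exists>\<phi>0 D0. smooth_derivs {0..} \<phi>0 D0 \<and>
             (\<forall>x\<ge>0. D0 2 x = sin (\<phi>0 x) * cos (\<phi>0 x)) \<and>
             \<phi>0 0 = 0 \<and> D0 1 0 = \<alpha>0 \<and>
             (\<forall>K. compact K \<and> K \<subseteq> {0..} \<longrightarrow> (\<forall>k::nat. \<forall>\<epsilon>>0. \<exists>\<beta>0>0. \<forall>\<beta>. 0 < \<beta> \<and> \<beta> < \<beta>0 \<longrightarrow>
                (\<exists>D. smooth_derivs {0..1} (\<phi> \<beta>) D \<and>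
                     (\<forall>x\<in>K. \<bar>\<beta> ^ k * D k (\<beta> * x) - D0 k x\<bar> \<le> \<epsilon>)))))"
      by (intro conjI energy, rule exI[of _ "orbit a0"], rule exI[of _ "orbit_derivs a0"], intro conjI allI impI conv)
        (use smooth_derivs_orbit[OF a0(1), of "{0..}"] a0(1) in \<open>auto simp: \<alpha>0 speed_def simp del: One_nat_def\<close>)
  qed
  ultimately show ?thesis by blast
qed

end
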